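(* Let $H:\mathbb{T}^n\times\mathbb{R}^n\times\mathbb{R}\to\mathbb{R}$ be continuous and satisfy: (A1) $p\mapsto H(x,p,\theta)$ is convex for every $(x,\theta)$; (A2) $\lim_{|p|\to\infty}H(x,p,\theta)/|p|=+\infty$ for every $(x,\theta)$; (A3) $\partial_\theta H(x,p,\theta)$ is continuous and non-negative everywhere. Let $\overline H$ be the effective Hamiltonian defined in the context. For $c\in\mathbb{R}$ and $\varepsilon>0$ consider $$H\left(\tfrac{x}{\varepsilon},d_xu,u\right)=c,\quad x\in\varepsilon\mathbb{T}^n,\qquad (E_\varepsilon)$$ $$\overline H(d_xu,u)=c,\quad x\in\mathbb{R}^n.\qquad (\overline E)$$ (i) Let $\mathcal{C}:=\{\overline H(0,\theta) : \theta\in\mathbb{R}\}$, i.e. the set of values $\overline H(0,\theta)$, $\theta \in \mathbb{R}$, for which $H(x,d_xu,\theta)=\overline H(0,\theta)$ on $\mathbb{T}^n$ admits a continuous solution. For any fixed $c\in\mathcal{C}$, the equations $(E_\varepsilon)$ and $(\overline E)$ are simultaneously solvable for all $\varepsilon>0$. Moreover, $\mathcal{C}$ is a connected subset of $\mathbb{R}$. (ii) Let $c\in\mathrm{int}\,\mathcal{C}$ and $I(c):=\{\theta\in\mathbb{R} : \overline H(0,\theta)=c\}$. If $\inf I(c)>-\infty$, then the function $$u_\varepsilon^-:=\inf\{\omega\in C(\varepsilon\mathbb{T}^n,\mathbb{R}) : \omega\text{ is a solution of }(E_\varepsilon)\}$$ is the minimal solution of $(E_\varepsilon)$, and there is a constant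 $C=C(H,c)>0$ such that $\|u_\varepsilon^--\inf I(c)\|_{L^\infty(\mathbb{R}^n)}\le C\varepsilon$ for all $\varepsilon\in(0,1]$. Similarly, if $\sup I(c)<+\infty$, then the function $$u_\varepsilon^+:=\sup\{\omega\in C(\varepsilon\mathbb{T}^n,\mathbb{R}) : \omega\text{ is a solution of }(E_\varepsilon)\}$$ is the maximal solution of $(E_\varepsilon)$, and $\|u_\varepsilon^+-\sup I(c)\|_{L^\infty(\mathbb{R}^n)}\le C\varepsilon$ for all $\varepsilon\in(0,1]$. (iii) For any $c\in\mathcal{C}$ such that $I(c)=\{\theta\}$ is a singleton, $u\equiv\theta$ is the unique solution of $(\overline E)$ in $\mathrm{BUC}(\mathbb{R}^n,\mathbb{R})$. Consequently, there exists $C=C(H,c)>0$ such that for any solution $u_\varepsilon$ of $(E_\varepsilon)$, $\|u_\varepsilon-u\|_{L^\infty(\mathbb{R}^n)}\le C\varepsilon$ for all $\varepsilon\in(0,1]$.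
   Context: $\mathbb{T}^n=\mathbb{R}^n/\mathbb{Z}^n$ and $\varepsilon\mathbb{T}^n=\mathbb{R}^n/\varepsilon\mathbb{Z}^n$; functions on $\varepsilon\mathbb{T}^n$ are identified with $\varepsilon\mathbb{Z}^n$-periodic functions on $\mathbb{R}^n$. All solutions are continuous solutions in the viscosity sense. $\mathrm{BUC}(\mathbb{R}^n,\mathbb{R})$ is the space of bounded uniformly continuous functions. $d_xu$ (or $du$) denotes the gradient. Effective Hamiltonian: for $(p,\theta)\in\mathbb{R}^n\times\mathbb{R}$, $\overline H(p,\theta)$ is the unique real number for which $H(x,p+d_xu,\theta)=\overline H(p,\theta)$, $x\in\mathbb{T}^n$, admits a continuous viscosity solution $u$ on $\mathbb{T}^n$ (existence and uniqueness of this number are known). *)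

theory Defs
  imports "HOL-Analysis.Analysis" "HOL-Probability.Essential_Supremum"
begin

text \<open>
  A function on the torus of side \<open>\<epsilon>\<close> is identified with a function on \<open>real^'n\<close> that is
  periodic under the lattice \<open>\<epsilon>\<int>\<^sup>n\<close>.
\<close>

definition lattice_periodic :: "real \<Rightarrow> (real^'n \<Rightarrow> 'b) \<Rightarrow> bool" where
  "lattice_periodic \<epsilon> f \<longleftrightarrow> (\<forall>x k. (\<forall>i. k $ i \<in> \<int>) \<longrightarrow> f (x + \<epsilon> *\<^sub>R k) = f x)"

text \<open>
  Viscosity solutions on the whole space of \<open>F(x, du, u) = c\<close>, the arguments of \<open>F\<close> being
  position, gradient and value in this order.  Test functions are \<open>C\<^sup>1\<close>, with gradient field \<open>g\<close>.
  They are not required to be periodic: the condition is local, so for periodic \<open>F\<close> and \<open>u\<close>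
  this is the notion on the torus.
\<close>

definition C1_with_gradient ::
    "('a::euclidean_space \<Rightarrow> real) \<Rightarrow> ('a \<Rightarrow> 'a) \<Rightarrow> bool" where
  "C1_with_gradient \<phi> g \<longleftrightarrow> (\<forall>x. GDERIV \<phi> x :> g x) \<and> continuous_on UNIV g"

definition viscosity_subsolution ::
    "('a::euclidean_space \<Rightarrow> 'a \<Rightarrow> real \<Rightarrow> real) \<Rightarrow> real \<Rightarrow> ('a \<Rightarrow> real) \<Rightarrow> bool" where
  "viscosity_subsolution F c u \<longleftrightarrow>
     (\<forall>\<phi> g x. C1_with_gradient \<phi> g \<longrightarrow>
        (\<forall>\<^sub>F y in nhds x. u y - \<phi> y \<le> u x - \<phi> x) \<longrightarrow> F x (g x) (u x) \<le> c)"

definition viscosity_supersolution ::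
    "('a::euclidean_space \<Rightarrow> 'a \<Rightarrow> real \<Rightarrow> real) \<Rightarrow> real \<Rightarrow> ('a \<Rightarrow> real) \<Rightarrow> bool" where
  "viscosity_supersolution F c u \<longleftrightarrow>
     (\<forall>\<phi> g x. C1_with_gradient \<phi> g \<longrightarrow>
        (\<forall>\<^sub>F y in nhds x. u x - \<phi> x \<le> u y - \<phi> y) \<longrightarrow> c \<le> F x (g x) (u x))"

definition viscosity_solution ::
    "('a::euclidean_space \<Rightarrow> 'a \<Rightarrow> real \<Rightarrow> real) \<Rightarrow> real \<Rightarrow> ('a \<Rightarrow> real) \<Rightarrow> bool" where
  "viscosity_solution F c u \<longleftrightarrow>
     continuous_on UNIV u \<and> viscosity_subsolution F c u \<and> viscosity_supersolution F c u"

definition effective_hamiltonian ::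
    "(real^'n \<Rightarrow> real^'n \<Rightarrow> real \<Rightarrow> real) \<Rightarrow> real^'n \<Rightarrow> real \<Rightarrow> real" where
  "effective_hamiltonian H p \<theta> =
     (THE c. \<exists>u. lattice_periodic 1 u \<and> viscosity_solution (\<lambda>x q _. H x (p + q) \<theta>) c u)"

text \<open>The continuous solutions of \<open>H(x/\<epsilon>, du, u) = c\<close> on the torus of side \<open>\<epsilon>\<close>.\<close>

definition eps_solutions ::
    "(real^'n \<Rightarrow> real^'n \<Rightarrow> real \<Rightarrow> real) \<Rightarrow> real \<Rightarrow> real \<Rightarrow> (real^'n \<Rightarrow> real) set" where
  "eps_solutions H c \<epsilon> =
     {u. lattice_periodic \<epsilon> u \<and> viscosity_solution (\<lambda>x p \<theta>. H (x /\<^sub>R \<epsilon>) p \<theta>) c u}"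

definition homogenized_solutions ::
    "(real^'n \<Rightarrow> real^'n \<Rightarrow> real \<Rightarrow> real) \<Rightarrow> real \<Rightarrow> (real^'n \<Rightarrow> real) set" where
  "homogenized_solutions H c = {u. viscosity_solution (\<lambda>x p \<theta>. effective_hamiltonian H p \<theta>) c u}"

definition critical_values :: "(real^'n \<Rightarrow> real^'n \<Rightarrow> real \<Rightarrow> real) \<Rightarrow> real set" where
  "critical_values H = {effective_hamiltonian H 0 \<theta> | \<theta>. \<theta> \<in> UNIV}"

definition level_set :: "(real^'n \<Rightarrow> real^'n \<Rightarrow> real \<Rightarrow> real) \<Rightarrow> real \<Rightarrow> real set" where
  "level_set H c = {\<theta>. effective_hamiltonian H 0 \<theta> = c}"

text \<open>
  Pointwise infimum and supremum over all solutions.  The real-valued \<open>Inf\<close> and \<open>Sup\<close> carry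
  their meaning only for nonempty sets bounded on the relevant side.  If the infimum (supremum)
  is itself a solution lying below (above) every solution, both conditions hold at each point.
\<close>

definition u_minus ::
    "(real^'n \<Rightarrow> real^'n \<Rightarrow> real \<Rightarrow> real) \<Rightarrow> real \<Rightarrow> real \<Rightarrow> real^'n \<Rightarrow> real" where
  "u_minus H c \<epsilon> = (\<lambda>x. INF \<omega>\<in>eps_solutions H c \<epsilon>. \<omega> x)"

definition u_plus ::
    "(real^'n \<Rightarrow> real^'n \<Rightarrow> real \<Rightarrow> real) \<Rightarrow> real \<Rightarrow> real \<Rightarrow> real^'n \<Rightarrow> real" where
  "u_plus H c \<epsilon> = (\<lambda>x. SUP \<omega>\<in>eps_solutions H c \<epsilon>. \<omega> x)"

definition BUC :: "(real^'n \<Rightarrow> real) set" where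
  "BUC = {u. bounded (range u) \<and> uniformly_continuous_on UNIV u}"

definition Linf_norm :: "(real^'n \<Rightarrow> real) \<Rightarrow> ereal" where
  "Linf_norm f = esssup lebesgue (\<lambda>x. ereal \<bar>f x\<bar>)"

end

theory Submission
  imports Defs "HOL-Complex_Analysis.Great_Picard"
begin

text \<open>
  The whole theorem rests on monotonicity in the value \<open>\<theta>\<close> together with one compactness
  mechanism.  Coercivity makes a bounded continuous subsolution Lipschitz, with a constant that
  depends only on a lower bound for its values (\<open>subsolution_lipschitz\<close>).  Hence suprema, infima
  and limits of the functions that occur stay continuous, and Perron's method (\<open>perron\<close>) yields a
  solution between a subsolution and a supersolution above it, both bounded and continuous.  Perron's
  method is run among all functions on the whole space: a class of competitors invariant under the
  lattice has an invariant supremum, so periodicity comes for free.  Uniqueness enters only through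
  a comparison principle for strict inequalities (\<open>comparison\<close>): a subsolution at level \<open>c\<^sub>1\<close> lies
  below a supersolution at a level \<open>c\<^sub>2 > c\<^sub>1\<close>.  At equal levels comparison fails, and this is why
  least and greatest solutions have to be distinguished.
  
  The effective Hamiltonian is obtained from the discounted problems \<open>H(x, p + du, \<theta>) + \<mu> u = 0\<close>
  as \<open>\<mu> \<rightarrow> 0\<close> (\<open>cell_solution_exists\<close>).  It is continuous, and nondecreasing in \<open>\<theta>\<close>; therefore the
  set of critical values is connected, and each level set \<open>I(c)\<close> is a closed interval.
  
  The rate comes from correctors.  If \<open>w\<close> solves the cell problem at \<open>(0, \<theta>)\<close> and takes values in
  \<open>[0, C]\<close>, then monotonicity in \<open>\<theta>\<close> makes \<open>\<theta> + \<epsilon> (w(x/\<epsilon>) - C)\<close> a subsolution and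
  \<open>\<theta> + \<epsilon> w(x/\<epsilon>)\<close> a supersolution of the oscillating equation at level \<open>Hbar 0 \<theta>\<close>, both within
  \<open>C \<epsilon>\<close> of \<open>\<theta>\<close> (\<open>barriers\<close>).  For \<open>\<theta> \<in> I(c)\<close> Perron's method between the two gives a solution
  close to \<open>\<theta>\<close>.  For \<open>\<theta> < inf I(c)\<close> the level \<open>Hbar 0 \<theta>\<close> is below \<open>c\<close>, so the strict comparison puts
  the lower barrier below every solution; letting \<open>\<theta>\<close> increase to \<open>inf I(c)\<close> bounds all solutions
  from below by \<open>inf I(c) - C \<epsilon>\<close>.  The upper bound is symmetric, and the two together give all the
  estimates.  The same barriers trap the solutions, so that the least one is the Perron solution
  between a lower barrier and the pointwise infimum of all solutions, and the greatest one is the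
  Perron solution below an upper barrier.
  
  For the homogenized equation, subtracting a small quadratic from a bounded solution produces
  contact points with almost vanishing gradient near the supremum; this forces the supremum, and
  symmetrically the infimum, into the singleton \<open>I(c)\<close>.
\<close>

section \<open>Test functions\<close>

lemma C1_add:
  assumes "C1_with_gradient f a" "C1_with_gradient h b"
  shows "C1_with_gradient (\<lambda>x. f x + h x) (\<lambda>x. a x + b x)"
  using assms unfolding C1_with_gradient_def
  by (auto intro!: GDERIV_add continuous_intros)

lemma C1_minus:
  assumes "C1_with_gradient f a"
  shows "C1_with_gradient (\<lambda>x. - f x) (\<lambda>x. - a x)"
  using assms unfolding C1_with_gradient_def
  by (auto intro!: GDERIV_minus continuous_intros)

text \<open>
  Paraboloids are the explicit test functions of all the arguments below, alone or added to a given
  test function.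
\<close>

lemma C1_paraboloid:
  "C1_with_gradient (\<lambda>x. k + a * (norm (x - z))\<^sup>2) (\<lambda>x. (2 * a) *\<^sub>R (x - z))"
  unfolding C1_with_gradient_def gderiv_def power2_norm_eq_inner
  by (auto intro!: derivative_eq_intros continuous_intros simp: inner_commute)

lemma C1_rescale:
  assumes "C1_with_gradient f g" "b \<noteq> 0"
  shows "C1_with_gradient (\<lambda>x. f (b *\<^sub>R x + \<tau>) / b) (\<lambda>x. g (b *\<^sub>R x + \<tau>))"
proof -
  have "GDERIV (\<lambda>x. f (b *\<^sub>R x + \<tau>) / b) x :> g (b *\<^sub>R x + \<tau>)" for x
  proof -
    have "(f has_derivative (\<lambda>h. h \<bullet> g (b *\<^sub>R x + \<tau>))) (at (b *\<^sub>R x + \<tau>))"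
      using assms unfolding C1_with_gradient_def gderiv_def by auto
    moreover have "((\<lambda>x. b *\<^sub>R x + \<tau>) has_derivative (\<lambda>h. b *\<^sub>R h)) (at x)"
      by (auto intro!: derivative_eq_intros)
    ultimately have "((\<lambda>x. f (b *\<^sub>R x + \<tau>)) has_derivative (\<lambda>h. (b *\<^sub>R h) \<bullet> g (b *\<^sub>R x + \<tau>))) (at x)"
      by (rule has_derivative_compose[rotated])
    from has_derivative_mult_right[OF this, of "1/b"] show ?thesis
      using assms(2) unfolding gderiv_def by simp
  qed
  moreover have "continuous_on UNIV g" using assms by (simp add: C1_with_gradient_def)
  then have "continuous_on UNIV (\<lambda>x. g (b *\<^sub>R x + \<tau>))"
    by (rule continuous_on_compose2) (auto intro!: continuous_intros)
  ultimately show ?thesis by (simp add: C1_with_gradient_def)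
qed

lemma C1_continuous:
  assumes "C1_with_gradient f g" shows "continuous_on UNIV f"
  using assms unfolding C1_with_gradient_def gderiv_def
  by (meson continuous_at_imp_continuous_on has_derivative_continuous)

lemma gradient_eq_of_touching:
  assumes "GDERIV f x :> a" "GDERIV h x :> b" "\<forall>\<^sub>F y in nhds x. f y - h y \<le> f x - h x"
  shows "a = b"
proof -
  have "((\<lambda>y. f y - h y) has_derivative (\<lambda>v. v \<bullet> a - v \<bullet> b)) (at x)"
    using assms unfolding gderiv_def by (intro has_derivative_diff)
  moreover obtain S where "open S" "x \<in> S" "\<forall>y\<in>S. f y - h y \<le> f x - h x"
    using assms(3) unfolding eventually_nhds by auto
  ultimately have "(\<lambda>v. v \<bullet> a - v \<bullet> b) = (\<lambda>v. 0)"
    by (intro differential_zero_maxmin[of x S]) auto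
  then have "(a - b) \<bullet> a - (a - b) \<bullet> b = 0" by metis
  then show ?thesis by (simp flip: inner_diff_right)
qed

section \<open>Elementary properties of viscosity solutions\<close>

lemma subsolutionD:
  assumes "viscosity_subsolution F c u" "C1_with_gradient \<phi> g"
    and "\<forall>\<^sub>F y in nhds x. u y - \<phi> y \<le> u x - \<phi> x"
  shows "F x (g x) (u x) \<le> c"
  using assms unfolding viscosity_subsolution_def by blast

lemma supersolutionD:
  assumes "viscosity_supersolution F c u" "C1_with_gradient \<phi> g"
    and "\<forall>\<^sub>F y in nhds x. u x - \<phi> x \<le> u y - \<phi> y"
  shows "c \<le> F x (g x) (u x)"
  using assms unfolding viscosity_supersolution_def by blast

text \<open>
  The reflection \<open>u \<mapsto> -u\<close> exchanges the two notions, so that statements about supersolutions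
  follow from those about subsolutions.  It maps \<open>F\<close> to \<open>(x, p, s) \<mapsto> -F(x, -p, -s)\<close>, which keeps
  continuity and monotonicity in \<open>s\<close>.
\<close>

lemma supersolution_iff_reflected_subsolution:
  "viscosity_supersolution F c u \<longleftrightarrow>
   viscosity_subsolution (\<lambda>x p s. - F x (- p) (- s)) (- c) (\<lambda>x. - u x)" (is "?L \<longleftrightarrow> ?R")
proof
  assume L: ?L
  show ?R
    unfolding viscosity_subsolution_def
  proof (intro allI impI)
    fix \<phi> :: "'a \<Rightarrow> real" and g x assume "C1_with_gradient \<phi> g" "\<forall>\<^sub>F y in nhds x. - u y - \<phi> y \<le> - u x - \<phi> x"
    then have "c \<le> F x (- g x) (u x)"
      by (intro supersolutionD[OF L C1_minus]) (auto elim!: eventually_mono)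
    then show "- F x (- g x) (- (- u x)) \<le> - c" by simp
  qed
next
  assume R: ?R
  show ?L
    unfolding viscosity_supersolution_def
  proof (intro allI impI)
    fix \<phi> :: "'a \<Rightarrow> real" and g x assume "C1_with_gradient \<phi> g" "\<forall>\<^sub>F y in nhds x. u x - \<phi> x \<le> u y - \<phi> y"
    then have "- F x (- (- g x)) (- (- u x)) \<le> - c"
      by (intro subsolutionD[OF R C1_minus]) (auto elim!: eventually_mono)
    then show "c \<le> F x (g x) (u x)" by simp
  qed
qed

text \<open>
  Only the values of the operators on the graph of \<open>u\<close> matter.  This is used to freeze or to
  release the dependence on \<open>u\<close>, for instance to pass from the frozen equation \<open>H(x, p + du, \<theta>) = c\<close>
  to the oscillating one.
\<close>

lemma subsolution_weaken:
  assumes "viscosity_subsolution F c u"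
    and "\<And>x p. F x p (u x) \<le> c \<Longrightarrow> G x p (u x) \<le> d"
  shows "viscosity_subsolution G d u"
  using assms unfolding viscosity_subsolution_def by meson

lemma supersolution_weaken:
  assumes "viscosity_supersolution F c u"
    and "\<And>x p. c \<le> F x p (u x) \<Longrightarrow> d \<le> G x p (u x)"
  shows "viscosity_supersolution G d u"
  using assms unfolding viscosity_supersolution_def by meson

lemma constant_subsolution:
  assumes "\<And>x. F x 0 k \<le> c"
  shows "viscosity_subsolution F c (\<lambda>x. k)"
  unfolding viscosity_subsolution_def
proof (intro allI impI)
  fix \<phi> :: "'a \<Rightarrow> real" and g x assume *: "C1_with_gradient \<phi> g" "\<forall>\<^sub>F y in nhds x. k - \<phi> y \<le> k - \<phi> x"
  then have "0 = g x"
    by (intro gradient_eq_of_touching[of "\<lambda>_. k" x 0 \<phi>])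
       (auto simp: C1_with_gradient_def GDERIV_const)
  then show "F x (g x) k \<le> c" using assms by metis
qed

lemma constant_supersolution:
  assumes "\<And>x. c \<le> F x 0 k"
  shows "viscosity_supersolution F c (\<lambda>x. k)"
  unfolding supersolution_iff_reflected_subsolution
  by (rule constant_subsolution) (use assms in auto)

text \<open>
  One change of variables covers translations (\<open>b = 1\<close>), the addition of constants
  (\<open>b = 1\<close>, \<open>\<tau> = 0\<close>) and the passage to the scale \<open>\<epsilon> = 1/b\<close>: the division by \<open>b\<close> keeps gradients
  unchanged.
\<close>

lemma subsolution_rescale:
  assumes "viscosity_subsolution F c w" "0 < b"
  shows "viscosity_subsolution (\<lambda>x p s. F (b *\<^sub>R x + \<tau>) p (b * (s - k))) c (\<lambda>x. k + w (b *\<^sub>R x + \<tau>) / b)"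
  unfolding viscosity_subsolution_def
proof (intro allI impI)
  fix \<phi> :: "'a \<Rightarrow> real" and g x
  assume \<phi>: "C1_with_gradient \<phi> g"
    and max: "\<forall>\<^sub>F y in nhds x. k + w (b *\<^sub>R y + \<tau>) / b - \<phi> y \<le> k + w (b *\<^sub>R x + \<tau>) / b - \<phi> x"
  define T where "T y = (1/b) *\<^sub>R y + (- (1/b) *\<^sub>R \<tau>)" for y :: 'a
  have T: "T (b *\<^sub>R y + \<tau>) = y" "b *\<^sub>R T y + \<tau> = y" for y
    using assms(2) by (simp_all add: T_def algebra_simps)
  have C1: "C1_with_gradient (\<lambda>y. \<phi> (T y) / (1/b)) (\<lambda>y. g (T y))"
    unfolding T_def using assms(2) by (intro C1_rescale \<phi>) simp
  define z where "z = b *\<^sub>R x + \<tau>"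
  have "(T \<longlongrightarrow> T z) (nhds z)"
    unfolding T_def by (intro tendsto_intros filterlim_ident)
  then have "filterlim T (nhds x) (nhds z)" by (simp add: z_def T)
  from eventually_compose_filterlim[OF max this]
  have "\<forall>\<^sub>F y in nhds z. w y / b - \<phi> (T y) \<le> w z / b - \<phi> (T z)"
    by (simp add: T z_def)
  then have "\<forall>\<^sub>F y in nhds z. w y - \<phi> (T y) / (1/b) \<le> w z - \<phi> (T z) / (1/b)"
  proof eventually_elim
    case (elim y)
    from mult_left_mono[OF this, of b] show ?case
      using assms(2) by (simp add: right_diff_distrib mult.commute)
  qed
  from subsolutionD[OF assms(1) C1 this]
  show "F (b *\<^sub>R x + \<tau>) (g x) (b * (k + w (b *\<^sub>R x + \<tau>) / b - k)) \<le> c"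
    using assms(2) by (simp add: z_def T)
qed

lemma supersolution_rescale:
  assumes "viscosity_supersolution F c w" "0 < b"
  shows "viscosity_supersolution (\<lambda>x p s. F (b *\<^sub>R x + \<tau>) p (b * (s - k))) c (\<lambda>x. k + w (b *\<^sub>R x + \<tau>) / b)"
  using subsolution_rescale[OF assms(1)[unfolded supersolution_iff_reflected_subsolution] assms(2), of \<tau> "-k"]
  unfolding supersolution_iff_reflected_subsolution
  by (simp add: algebra_simps)

lemma jointly_continuous_nbhd:
  fixes F :: "'a::euclidean_space \<Rightarrow> 'a \<Rightarrow> real \<Rightarrow> real"
  assumes "continuous_on UNIV (\<lambda>(x, p, s). F x p s)" "c < F x p s"
  shows "\<exists>d>0. \<forall>x' p' s'. dist x' x < d \<longrightarrow> dist p' p < d \<longrightarrow> dist s' s < d \<longrightarrow> c < F x' p' s'"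
proof -
  have "open {z. c < (\<lambda>(x, p, s). F x p s) z}"
    using assms(1) by (intro open_Collect_less continuous_intros)
  moreover have "(x, p, s) \<in> {z. c < (\<lambda>(x, p, s). F x p s) z}" using assms by simp
  ultimately obtain d where d: "d > 0" "\<And>z. dist z (x, p, s) < d \<Longrightarrow> c < (\<lambda>(x, p, s). F x p s) z"
    unfolding open_dist by blast
  show ?thesis
  proof (intro exI[of _ "d/3"] conjI allI impI)
    fix x' p' s' assume *: "dist x' x < d/3" "dist p' p < d/3" "dist s' s < d/3"
    have "dist (x', p', s') (x, p, s) \<le> dist x' x + (dist p' p + dist s' s)"
      by (metis (no_types) dist_Pair_Pair add_left_mono order_trans sqrt_sum_squares_le_sum zero_le_dist)
    then show "c < F x' p' s'" using d(2)[of "(x', p', s')"] * by auto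
  qed (use d in auto)
qed

text \<open>
  The approximating \<open>w\<close> has to stay below \<open>u + e\<close> on a ball, but needs to be close to \<open>u\<close> from below
  only at the centre.  This weak form applies both to uniform limits and to pointwise suprema of
  subsolutions.  The reason: adding \<open>norm (y - x)^2\<close> to a test function makes the maximum at \<open>x\<close>
  strict, and then the maximum of \<open>w\<close> minus the test function over the ball is attained in the
  interior, close to \<open>x\<close>.
\<close>

lemma subsolution_stability:
  fixes F :: "'a::euclidean_space \<Rightarrow> 'a \<Rightarrow> real \<Rightarrow> real"
  assumes F: "continuous_on UNIV (\<lambda>(x, p, s). F x p s)" and u: "continuous_on UNIV u"
    and approx: "\<And>x e r. 0 < e \<Longrightarrow> \<exists>w. continuous_on UNIV w \<and> viscosity_subsolution F (c + e) w \<and>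
           (\<forall>y\<in>cball x r. w y \<le> u y + e) \<and> u x - e \<le> w x"
  shows "viscosity_subsolution F c u"
  unfolding viscosity_subsolution_def
proof (intro allI impI)
  fix \<phi> :: "'a \<Rightarrow> real" and g x
  assume \<phi>: "C1_with_gradient \<phi> g" and max: "\<forall>\<^sub>F y in nhds x. u y - \<phi> y \<le> u x - \<phi> x"
  show "F x (g x) (u x) \<le> c"
  proof (rule ccontr)
    assume "\<not> F x (g x) (u x) \<le> c"
    then obtain \<eta> where \<eta>: "\<eta> > 0" "c + \<eta> < F x (g x) (u x)"
      by (metis add_diff_cancel_left' diff_gt_0_iff_gt dense less_diff_eq add.commute not_le)
    obtain d where d: "d > 0"
      "\<And>x' p' s'. dist x' x < d \<Longrightarrow> dist p' (g x) < d \<Longrightarrow> dist s' (u x) < d \<Longrightarrow> c + \<eta> < F x' p' s'"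
      using jointly_continuous_nbhd[OF F \<eta>(2)] by metis
    have lim: "(u \<longlongrightarrow> u x) (nhds x)" "(\<phi> \<longlongrightarrow> \<phi> x) (nhds x)" "(g \<longlongrightarrow> g x) (nhds x)"
      using u C1_continuous[OF \<phi>] \<phi> unfolding C1_with_gradient_def
      by (auto simp: continuous_on_eq_continuous_at tendsto_nhds_iff isCont_def)
    have gl: "((\<lambda>y. g y + 2 *\<^sub>R (y - x)) \<longlongrightarrow> g x + 2 *\<^sub>R (x - x)) (nhds x)"
      by (intro tendsto_intros lim filterlim_ident)
    have "\<forall>\<^sub>F y in nhds x. u y - \<phi> y \<le> u x - \<phi> x \<and> dist y x < d \<and> dist (u y) (u x) < d/2 \<and>
         dist (\<phi> y) (\<phi> x) < d/2 \<and> dist (g y + 2 *\<^sub>R (y - x)) (g x) < d"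
      using max tendstoD[OF lim(1), of "d/2"] tendstoD[OF lim(2), of "d/2"] tendstoD[OF gl, of d] d(1)
        tendstoD[OF filterlim_ident, of d x]
      by (auto intro!: eventually_conj)
    then obtain \<rho> where \<rho>: "\<rho> > 0" "\<And>y. dist y x < \<rho> \<Longrightarrow> u y - \<phi> y \<le> u x - \<phi> x \<and> dist y x < d \<and> 
       dist (u y) (u x) < d/2 \<and> dist (\<phi> y) (\<phi> x) < d/2 \<and> dist (g y + 2 *\<^sub>R (y - x)) (g x) < d"
      unfolding eventually_nhds_metric by blast
    define r where "r = \<rho>/2"
    have r: "r > 0" "r < \<rho>" using \<rho> by (auto simp: r_def)
    define e where "e = min (min \<eta> (d/2)) (r\<^sup>2/4)"
    have e: "0 < e" "e \<le> \<eta>" "e \<le> d/2" "4 * e \<le> r\<^sup>2"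
      using \<eta> d r unfolding e_def min_def by auto
    obtain w where w: "continuous_on UNIV w" "viscosity_subsolution F (c + e) w"
      "\<And>y. y \<in> cball x r \<Longrightarrow> w y \<le> u y + e" "u x - e \<le> w x"
      using approx[OF e(1), of x r] by blast
    define \<psi> where "\<psi> y = \<phi> y + (0 + 1 * (norm (y - x))\<^sup>2)" for y
    have \<psi>: "C1_with_gradient \<psi> (\<lambda>y. g y + (2 * 1) *\<^sub>R (y - x))"
      unfolding \<psi>_def by (intro C1_add \<phi> C1_paraboloid)
    have "continuous_on (cball x r) (\<lambda>y. w y - \<psi> y)"
      by (intro continuous_intros continuous_on_subset[OF w(1)] continuous_on_subset[OF C1_continuous[OF \<psi>]]) auto
    then obtain z where z: "z \<in> cball x r" "\<And>y. y \<in> cball x r \<Longrightarrow> w y - \<psi> y \<le> w z - \<psi> z"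
      using continuous_attains_sup[of "cball x r" "\<lambda>y. w y - \<psi> y"] r by fastforce
    have zr: "dist z x < \<rho>" using z r by (auto simp: dist_commute)
    note \<rho>z = \<rho>(2)[OF zr]
    have zx: "w x - \<phi> x \<le> w z - \<phi> z - (norm (z - x))\<^sup>2"
      using z(2)[of x] r by (auto simp: \<psi>_def)
    have wz: "w z \<le> u z + e" using w(3) z by auto
    have "(norm (z - x))\<^sup>2 \<le> 2 * e" using zx wz w(4) \<rho>z by linarith
    also have "\<dots> < r\<^sup>2" using e r zero_less_power[OF r(1), of 2] by linarith
    finally have "norm (z - x) < r" using r by (simp add: power_less_imp_less_base)
    then have "z \<in> ball x r" by (simp add: dist_norm norm_minus_commute)
    then have "\<forall>\<^sub>F y in nhds z. y \<in> ball x r" by (intro eventually_nhds_in_open) auto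
    then have "\<forall>\<^sub>F y in nhds z. w y - \<psi> y \<le> w z - \<psi> z"
      by eventually_elim (use z in auto)
    from subsolutionD[OF w(2) \<psi> this] have "F z (g z + (2 * 1) *\<^sub>R (z - x)) (w z) \<le> c + e" .
    moreover have "c + \<eta> < F z (g z + (2 * 1) *\<^sub>R (z - x)) (w z)"
    proof (rule d(2))
      have "(norm (z - x))\<^sup>2 \<ge> 0" by simp
      then have "w z > u x - d"
        using zx w(4) \<rho>z e unfolding dist_real_def by linarith
      moreover have "w z < u x + d" using wz \<rho>z e unfolding dist_real_def by linarith
      ultimately show "dist (w z) (u x) < d" by (auto simp: dist_real_def)
    qed (use \<rho>z in auto)
    ultimately show False using e by linarith
  qed
qed

lemma supersolution_stability:
  fixes F :: "'a::euclidean_space \<Rightarrow> 'a \<Rightarrow> real \<Rightarrow> real"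
  assumes F: "continuous_on UNIV (\<lambda>(x, p, s). F x p s)" and u: "continuous_on UNIV u"
    and approx: "\<And>x e r. 0 < e \<Longrightarrow> \<exists>w. continuous_on UNIV w \<and> viscosity_supersolution F (c - e) w \<and>
           (\<forall>y\<in>cball x r. u y - e \<le> w y) \<and> w x \<le> u x + e"
  shows "viscosity_supersolution F c u"
  unfolding supersolution_iff_reflected_subsolution
proof (rule subsolution_stability)
  have "continuous_on UNIV (\<lambda>z. - ((\<lambda>(x, p, s). F x p s) ((\<lambda>(x, p, s). (x, - p, - s)) z)))"
    by (intro continuous_intros continuous_on_compose2[OF F]) (auto simp: case_prod_beta intro!: continuous_intros)
  then show "continuous_on UNIV (\<lambda>(x, p, s). - F x (- p) (- s))"
    by (simp add: case_prod_beta)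
next
  fix x :: 'a and e r :: real assume "0 < e"
  then obtain w where w: "continuous_on UNIV w" "viscosity_supersolution F (c - e) w"
           "\<forall>y\<in>cball x r. u y - e \<le> w y" "w x \<le> u x + e"
    using approx by blast
  show "\<exists>w. continuous_on UNIV w \<and> viscosity_subsolution (\<lambda>x p s. - F x (- p) (- s)) (- c + e) w \<and>
           (\<forall>y\<in>cball x r. w y \<le> - u y + e) \<and> - u x - e \<le> w x"
  proof (intro exI[of _ "\<lambda>x. - w x"] conjI ballI)
    show "viscosity_subsolution (\<lambda>x p s. - F x (- p) (- s)) (- c + e) (\<lambda>x. - w x)"
      using w(2) unfolding supersolution_iff_reflected_subsolution by simp
    fix y assume "y \<in> cball x r"
    then have "u y - e \<le> w y" using w(3) by blast
    then show "- w y \<le> - u y + e" by linarith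
  qed (use w(1,4) in \<open>simp_all add: continuous_on_minus\<close>)
qed (simp add: continuous_on_minus u)

section \<open>Lipschitz bounds\<close>

lemma attains_global_max:
  fixes f :: "'a::euclidean_space \<Rightarrow> real"
  assumes "continuous_on UNIV f" "\<And>y. R < norm (y - x) \<Longrightarrow> f y \<le> f x"
  obtains z where "\<And>y. f y \<le> f z"
proof -
  let ?B = "cball x (max R 0)"
  obtain z where z: "z \<in> ?B" "\<And>y. y \<in> ?B \<Longrightarrow> f y \<le> f z"
    using continuous_attains_sup[of ?B f] continuous_on_subset[OF assms(1), of ?B] by fastforce
  have "f y \<le> f z" for y
  proof (cases "y \<in> ?B")
    case False
    then have "R < norm (y - x)" by (auto simp: dist_norm norm_minus_commute)
    moreover have "f x \<le> f z" using z(2)[of x] by simp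
    ultimately show ?thesis using assms(2) order_trans by blast
  qed (use z in blast)
  then show thesis by (rule that)
qed

text \<open>
  The cone with vertex \<open>x\<close> and slope \<open>K\<close>, raised until it lies above \<open>u\<close>, can touch \<open>u\<close> only at its
  vertex, since anywhere else it would be a test function whose gradient has norm \<open>K\<close>.
\<close>

lemma subsolution_lipschitz:
  fixes u :: "'a::euclidean_space \<Rightarrow> real"
  assumes u: "continuous_on UNIV u" "\<And>x. \<bar>u x\<bar> \<le> B"
    and sub: "viscosity_subsolution F c u"
    and K: "0 < K" "\<And>x p. F x p (u x) \<le> c \<Longrightarrow> norm p < K"
  shows "u y - u x \<le> K * norm (y - x)"
proof -
  define f where "f y = u y - K * norm (y - x)" for y
  have cont: "continuous_on UNIV f"
    unfolding f_def by (intro continuous_intros u)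
  have "f y \<le> f x" if "2 * B / K < norm (y - x)" for y
  proof -
    have "2 * B < K * norm (y - x)" using that K by (simp add: field_simps)
    then show ?thesis using u(2)[of x] u(2)[of y] by (simp add: f_def abs_le_iff)
  qed
  then obtain z where z: "\<And>y. f y \<le> f z" using attains_global_max[OF cont] by metis
  have "z = x"
  proof (rule ccontr)
    assume "z \<noteq> x"
    define r where "r = norm (z - x)"
    have r: "r > 0" using \<open>z \<noteq> x\<close> by (simp add: r_def)
    \<comment> \<open>By the arithmetic-geometric mean inequality this paraboloid lies above the cone
        \<open>K * norm (y - x)\<close> and touches it exactly at distance \<open>r\<close>.\<close>
    define \<phi> where "\<phi> y = K * r / 2 + (K / (2 * r)) * (norm (y - x))\<^sup>2" for y
    have \<phi>: "C1_with_gradient \<phi> (\<lambda>y. (2 * (K / (2 * r))) *\<^sub>R (y - x))"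
      unfolding \<phi>_def by (rule C1_paraboloid)
    have above: "K * norm (y - x) \<le> \<phi> y" for y
    proof -
      have "\<phi> y - K * norm (y - x) = K / (2 * r) * (norm (y - x) - r)\<^sup>2"
        using r by (simp add: \<phi>_def field_simps power2_eq_square)
      also have "\<dots> \<ge> 0" using K r by simp
      finally show ?thesis by simp
    qed
    have at: "\<phi> z = K * norm (z - x)"
      using r by (simp add: \<phi>_def r_def[symmetric] field_simps power2_eq_square)
    have "u y - \<phi> y \<le> u z - \<phi> z" for y
      using z[of y] above[of y] at unfolding f_def by linarith
    then have "F z ((2 * (K / (2 * r))) *\<^sub>R (z - x)) (u z) \<le> c"
      by (intro subsolutionD[OF sub \<phi>]) simp
    then have "norm ((2 * (K / (2 * r))) *\<^sub>R (z - x)) < K" by (rule K)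
    then show False using r K by (simp add: r_def)
  qed
  then show ?thesis using z[of y] by (simp add: f_def)
qed

lemma lipschitz_continuous:
  fixes u :: "'a::euclidean_space \<Rightarrow> real"
  assumes "\<And>x y. u y - u x \<le> K * norm (y - x)" "0 < K"
  shows "continuous_on UNIV u"
proof -
  have "\<bar>u y - u x\<bar> \<le> K * norm (y - x)" for x y
    using assms(1)[of x y] assms(1)[of y x] by (simp add: norm_minus_commute abs_le_iff)
  then have "K-lipschitz_on UNIV u"
    using assms(2) by (auto simp: lipschitz_on_def dist_norm dist_real_def)
  then show ?thesis by (rule lipschitz_on_continuous_on)
qed

section \<open>Perron's method\<close>

lemma max_subsolution:
  assumes "viscosity_subsolution F c u" "viscosity_subsolution F c v"
  shows "viscosity_subsolution F c (\<lambda>x. max (u x) (v x))"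
  unfolding viscosity_subsolution_def
proof (intro allI impI)
  fix \<phi> :: "'a \<Rightarrow> real" and g x
  assume *: "C1_with_gradient \<phi> g"
    "\<forall>\<^sub>F y in nhds x. max (u y) (v y) - \<phi> y \<le> max (u x) (v x) - \<phi> x"
  show "F x (g x) (max (u x) (v x)) \<le> c"
  proof (cases "v x \<le> u x")
    case True
    then have "\<forall>\<^sub>F y in nhds x. u y - \<phi> y \<le> u x - \<phi> x"
      using *(2) by (auto elim!: eventually_mono simp: max_absorb1)
    from subsolutionD[OF assms(1) *(1) this] True show ?thesis by (simp add: max_absorb1)
  next
    case False
    then have "\<forall>\<^sub>F y in nhds x. v y - \<phi> y \<le> v x - \<phi> x"
      using *(2) by (auto elim!: eventually_mono simp: max_absorb2)
    from subsolutionD[OF assms(2) *(1) this] False show ?thesis by (simp add: max_absorb2)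
  qed
qed

text \<open>
  Where the pasted function agrees with \<open>u\<close> it touches \<open>u\<close> from above, so that its test functions
  are test functions for \<open>u\<close>.  Elsewhere it agrees with the smooth function \<open>\<phi>\<close>, whose gradient is
  then that of the test function.
\<close>

lemma bump_subsolution:
  assumes u: "viscosity_subsolution F c u"
    and \<phi>: "C1_with_gradient \<phi> g" and A: "open A"
    and strict: "\<And>x. x \<in> A \<Longrightarrow> F x (g x) (\<phi> x) \<le> c"
  shows "viscosity_subsolution F c (\<lambda>x. if x \<in> A then max (u x) (\<phi> x) else u x)"
    (is "viscosity_subsolution F c ?w")
  unfolding viscosity_subsolution_def
proof (intro allI impI)
  fix \<psi> :: "'a \<Rightarrow> real" and h x
  assume \<psi>: "C1_with_gradient \<psi> h" and max: "\<forall>\<^sub>F y in nhds x. ?w y - \<psi> y \<le> ?w x - \<psi> x"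
  have ge: "u y \<le> ?w y" for y by simp
  show "F x (h x) (?w x) \<le> c"
  proof (cases "?w x = u x")
    case True
    from max have "\<forall>\<^sub>F y in nhds x. u y - \<psi> y \<le> u x - \<psi> x"
    proof eventually_elim
      case (elim y) then show ?case using ge[of y] True by linarith
    qed
    from subsolutionD[OF u \<psi> this] True show ?thesis by simp
  next
    case False
    then have x: "x \<in> A" "?w x = \<phi> x" by (auto split: if_splits simp: max_def)
    have "\<forall>\<^sub>F y in nhds x. y \<in> A" using A x by (intro eventually_nhds_in_open)
    then have "\<forall>\<^sub>F y in nhds x. \<phi> y - \<psi> y \<le> \<phi> x - \<psi> x"
      using max
    proof eventually_elim
      case (elim y)
      then have "\<phi> y \<le> ?w y" by simp
      then show ?case using elim x(2) by linarith
    qed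
    then have "g x = h x"
      using \<phi> \<psi> unfolding C1_with_gradient_def by (intro gradient_eq_of_touching) auto
    then show ?thesis using strict[OF x(1)] x(2) by metis
  qed
qed

definition perron_family where
  "perron_family F c v \<psi> =
     {w. continuous_on UNIV w \<and> viscosity_subsolution F c w \<and> (\<forall>x. v x \<le> w x \<and> w x \<le> \<psi> x)}"

text \<open>
  The supremum \<open>u\<close> of the family is Lipschitz because its members are so with a common constant, and
  it is a subsolution by stability.  If it failed to be a supersolution at \<open>x\<close>, then it would lie
  strictly below \<open>\<psi>\<close> there, and lifting it slightly near \<open>x\<close> along a test function would give a
  larger member of the family.  The last conclusion gives periodicity: a translation that leaves all
  the data invariant permutes the family.
\<close>

theorem perron:
  fixes F :: "'a::euclidean_space \<Rightarrow> 'a \<Rightarrow> real \<Rightarrow> real"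
  assumes F: "continuous_on UNIV (\<lambda>(x, p, s). F x p s)"
    and v: "continuous_on UNIV v" "viscosity_subsolution F c v"
    and \<psi>: "continuous_on UNIV \<psi>" "viscosity_supersolution F c \<psi>"
    and le: "\<And>x. v x \<le> \<psi> x" and bd: "\<And>x. a \<le> v x" "\<And>x. \<psi> x \<le> b"
    and K: "\<And>x p s. a \<le> s \<Longrightarrow> F x p s \<le> c \<Longrightarrow> norm p < K" "0 < K"
  obtains u where "viscosity_solution F c u" "\<And>x. v x \<le> u x" "\<And>x. u x \<le> \<psi> x"
    "\<And>w x. continuous_on UNIV w \<Longrightarrow> viscosity_subsolution F c w \<Longrightarrow> (\<And>x. v x \<le> w x) \<Longrightarrow>
       (\<And>x. w x \<le> \<psi> x) \<Longrightarrow> w x \<le> u x"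
    "\<And>\<tau> x. (\<And>x p s. F (x + \<tau>) p s = F x p s) \<Longrightarrow> (\<And>x. v (x + \<tau>) = v x) \<Longrightarrow>
       (\<And>x. \<psi> (x + \<tau>) = \<psi> x) \<Longrightarrow> u (x + \<tau>) = u x"
proof -
  let ?P = "perron_family F c v \<psi>"
  define u where "u x = (SUP w\<in>?P. w x)" for x
  have P: "v \<in> ?P" using v le by (auto simp: perron_family_def)
  have PD: "continuous_on UNIV w" "viscosity_subsolution F c w" "v x \<le> w x" "w x \<le> \<psi> x" if "w \<in> ?P" for w x
    using that by (auto simp: perron_family_def)
  have bdd: "bdd_above ((\<lambda>w. w x) ` ?P)" for x
    by (rule bdd_aboveI[of _ "\<psi> x"]) (auto dest: PD)
  have upper: "w x \<le> u x" if "w \<in> ?P" for w x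
    unfolding u_def by (rule cSUP_upper[OF that bdd])
  have least: "u x \<le> k" if "\<And>w. w \<in> ?P \<Longrightarrow> w x \<le> k" for x k
    unfolding u_def using P that by (intro cSUP_least) auto
  have u\<psi>: "u x \<le> \<psi> x" for x by (rule least) (rule PD)
  have vu: "v x \<le> u x" for x by (rule upper[OF P])
  have approx: "\<exists>w\<in>?P. u x - e < w x" if "e > 0" for x e
  proof (rule ccontr)
    assume "\<not> ?thesis"
    then have "u x \<le> u x - e" by (intro least) force
    then show False using that by simp
  qed
  have lip: "w y - w x \<le> K * norm (y - x)" if w: "w \<in> ?P" for w x y
  proof (rule subsolution_lipschitz[OF PD(1)[OF w] _ PD(2)[OF w] K(2)])
    have aw: "a \<le> w z" for z using PD(3)[OF w, of z] bd(1)[of z] by linarith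
    then show "F z p (w z) \<le> c \<Longrightarrow> norm p < K" for z p by (rule K)
    show "\<bar>w z\<bar> \<le> \<bar>a\<bar> + \<bar>b\<bar>" for z
      using aw[of z] PD(4)[OF w, of z] bd(2)[of z] by linarith
  qed
  have lipu: "u y - u x \<le> K * norm (y - x)" for x y
  proof -
    have "u y \<le> u x + K * norm (y - x)"
    proof (rule least)
      fix w assume "w \<in> ?P"
      from lip[OF this, of y x] upper[OF this, of x] show "w y \<le> u x + K * norm (y - x)" by linarith
    qed
    then show ?thesis by linarith
  qed
  have u: "continuous_on UNIV u" using lipu K(2) by (rule lipschitz_continuous)
  have sub: "viscosity_subsolution F c u"
  proof (rule subsolution_stability[OF F u])
    fix x and e r :: real assume e: "0 < e"
    then obtain w where w: "w \<in> ?P" "u x - e < w x" using approx by blast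
    show "\<exists>w. continuous_on UNIV w \<and> viscosity_subsolution F (c + e) w \<and>
           (\<forall>y\<in>cball x r. w y \<le> u y + e) \<and> u x - e \<le> w x"
    proof (intro exI[of _ w] conjI ballI)
      show "viscosity_subsolution F (c + e) w"
        using PD(2)[OF w(1)] by (rule subsolution_weaken) (use e in auto)
      show "w y \<le> u y + e" for y using upper[OF w(1), of y] e by linarith
    qed (use w PD(1)[OF w(1)] in auto)
  qed
  have super: "viscosity_supersolution F c u"
    unfolding viscosity_supersolution_def
  proof (intro allI impI, rule ccontr)
    fix \<phi> :: "'a \<Rightarrow> real" and g x
    assume \<phi>: "C1_with_gradient \<phi> g" and min: "\<forall>\<^sub>F y in nhds x. u x - \<phi> x \<le> u y - \<phi> y"
      and "\<not> c \<le> F x (g x) (u x)"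
    then have lt: "- c < - F x (g x) (u x)" by simp
    have "u x \<noteq> \<psi> x"
    proof
      assume eq: "u x = \<psi> x"
      have "\<forall>\<^sub>F y in nhds x. \<psi> x - \<phi> x \<le> \<psi> y - \<phi> y"
        using min
      proof eventually_elim
        case (elim y) then show ?case using u\<psi>[of y] eq by linarith
      qed
      from supersolutionD[OF \<psi>(2) \<phi> this] eq lt show False by simp
    qed
    then have ltx: "u x < \<psi> x" using u\<psi>[of x] by linarith
    have F': "continuous_on UNIV (\<lambda>(x, p, s). - F x p s)"
      using continuous_on_minus[OF F] by (simp add: case_prod_beta)
    from jointly_continuous_nbhd[OF F' lt]
    obtain d where d: "d > 0"
      "\<And>x' p' s'. dist x' x < d \<Longrightarrow> dist p' (g x) < d \<Longrightarrow> dist s' (u x) < d \<Longrightarrow> F x' p' s' < c"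
      by auto
    define m where "m = \<psi> x - u x"
    have m: "m > 0" using ltx by (simp add: m_def)
    define \<theta> where "\<theta> \<delta> y = \<phi> y + ((u x - \<phi> x + \<delta>) + (- 1) * (norm (y - x))\<^sup>2)" for y \<delta>
    have \<theta>: "C1_with_gradient (\<theta> \<delta>) (\<lambda>y. g y + (2 * (- 1)) *\<^sub>R (y - x))" for \<delta>
      unfolding \<theta>_def by (intro C1_add \<phi> C1_paraboloid)
    have lim: "(\<psi> \<longlongrightarrow> \<psi> x) (nhds x)" "(\<phi> \<longlongrightarrow> \<phi> x) (nhds x)" "(g \<longlongrightarrow> g x) (nhds x)"
      using \<psi>(1) C1_continuous[OF \<phi>] \<phi> unfolding C1_with_gradient_def
      by (auto simp: continuous_on_eq_continuous_at tendsto_nhds_iff isCont_def)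
    have gl: "((\<lambda>y. g y + (2 * (- 1)) *\<^sub>R (y - x)) \<longlongrightarrow> g x + (2 * (- 1)) *\<^sub>R (x - x)) (nhds x)"
      by (intro tendsto_intros lim filterlim_ident)
    have \<theta>l: "(\<theta> 0 \<longlongrightarrow> \<phi> x + ((u x - \<phi> x + 0) + (- 1) * (norm (x - x))\<^sup>2)) (nhds x)"
      unfolding \<theta>_def by (intro tendsto_intros lim filterlim_ident)
    have "\<forall>\<^sub>F y in nhds x. u x - \<phi> x \<le> u y - \<phi> y \<and> dist y x < d \<and> dist (\<psi> y) (\<psi> x) < m/4 \<and>
         dist (\<theta> 0 y) (u x) < m/4 \<and> dist (\<theta> 0 y) (u x) < d/2 \<and>
         dist (g y + (2 * (- 1)) *\<^sub>R (y - x)) (g x) < d"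
      using min tendstoD[OF lim(1), of "m/4"] tendstoD[OF \<theta>l, of "m/4"] tendstoD[OF \<theta>l, of "d/2"]
        tendstoD[OF gl, of d] d(1) m tendstoD[OF filterlim_ident, of d x]
      by (auto intro!: eventually_conj)
    then obtain r where r: "r > 0" "\<And>y. y \<in> ball x r \<Longrightarrow> u x - \<phi> x \<le> u y - \<phi> y \<and> dist y x < d \<and>
         dist (\<psi> y) (\<psi> x) < m/4 \<and> dist (\<theta> 0 y) (u x) < m/4 \<and> dist (\<theta> 0 y) (u x) < d/2 \<and>
         dist (g y + (2 * (- 1)) *\<^sub>R (y - x)) (g x) < d"
      unfolding eventually_nhds_metric by (auto simp: dist_commute)
    \<comment> \<open>The bump has height \<open>\<delta>\<close>: the bounds by \<open>m/4\<close> and \<open>d/2\<close> keep it below \<open>\<psi>\<close> and in the region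
        where the subsolution inequality is strict, and the bound by \<open>(r/2)^2\<close> puts it below \<open>u\<close>
        outside the ball of radius \<open>r/2\<close>, so that the pasted function is continuous.\<close>
    define \<delta> where "\<delta> = min (min (m/4) (d/2)) ((r/2)\<^sup>2)"
    have \<delta>: "\<delta> > 0" "\<delta> \<le> m/4" "\<delta> \<le> d/2" "\<delta> \<le> (r/2)\<^sup>2"
      using m d r by (auto simp: \<delta>_def)
    have \<theta>\<delta>: "\<theta> \<delta> y = \<theta> 0 y + \<delta>" for y by (simp add: \<theta>_def)
    define w where "w y = (if y \<in> ball x r then max (u y) (\<theta> \<delta> y) else u y)" for y
    have subw: "viscosity_subsolution F c w"
      unfolding w_def
    proof (rule bump_subsolution[OF sub \<theta>])
      fix y assume "y \<in> ball x r"
      note ry = r(2)[OF this]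
      have "F y (g y + (2 * (- 1)) *\<^sub>R (y - x)) (\<theta> \<delta> y) < c"
      proof (rule d(2))
        show "dist (\<theta> \<delta> y) (u x) < d"
          using ry \<delta> unfolding \<theta>\<delta> dist_real_def by linarith
      qed (use ry in auto)
      then show "F y (g y + (2 * (- 1)) *\<^sub>R (y - x)) (\<theta> \<delta> y) \<le> c" by simp
    qed simp
    have outer: "w y = u y" if "y \<notin> cball x (r/2)" for y
    proof (cases "y \<in> ball x r")
      case True
      have "r/2 < norm (y - x)" using that by (simp add: dist_norm norm_minus_commute)
      then have "(r/2)\<^sup>2 < (norm (y - x))\<^sup>2" using r(1) by (intro power_strict_mono) auto
      then have "\<theta> \<delta> y \<le> u y" using r(2)[OF True] \<delta>(4) by (auto simp: \<theta>_def)
      then show ?thesis using True by (simp add: w_def)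
    qed (simp add: w_def)
    have "continuous_on (ball x r \<union> (- cball x (r/2))) w"
    proof (rule continuous_on_open_Un)
      have "continuous_on (ball x r) (\<lambda>y. max (u y) (\<theta> \<delta> y))"
        by (intro continuous_on_max continuous_on_subset[OF u] continuous_on_subset[OF C1_continuous[OF \<theta>]]) auto
      then show "continuous_on (ball x r) w" by (rule continuous_on_eq) (simp add: w_def)
      show "continuous_on (- cball x (r/2)) w"
        by (rule continuous_on_eq[of _ u]) (use outer in \<open>auto intro: continuous_on_subset[OF u]\<close>)
    qed auto
    moreover have "ball x r \<union> (- cball x (r/2)) = UNIV" using r(1) by auto
    ultimately have contw: "continuous_on UNIV w" by simp
    have "w \<in> ?P"
      unfolding perron_family_def
    proof (safe intro!: contw subw)
      fix y
      show "v y \<le> w y" using vu[of y] by (simp add: w_def le_max_iff_disj)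
      have "\<theta> \<delta> y \<le> \<psi> y" if "y \<in> ball x r"
      proof -
        have "dist (\<psi> y) (\<psi> x) < m/4" "dist (\<theta> 0 y) (u x) < m/4" using r(2)[OF that] by auto
        then have "\<psi> x - m/4 < \<psi> y" "\<theta> 0 y < u x + m/4"
          unfolding dist_real_def by linarith+
        moreover have "\<psi> x = u x + m" by (simp add: m_def)
        ultimately show ?thesis using \<delta>(2) m unfolding \<theta>\<delta> by linarith
      qed
      then show "w y \<le> \<psi> y" using u\<psi>[of y] by (simp add: w_def)
    qed
    from upper[OF this, of x] have "\<theta> \<delta> x \<le> u x" using r(1) by (simp add: w_def)
    then show False using \<delta>(1) by (simp add: \<theta>_def)
  qed
  have shift: "u (x + \<tau>) \<le> u x"
    if "\<And>x p s. F (x + \<tau>) p s = F x p s" "\<And>x. v (x + \<tau>) = v x" "\<And>x. \<psi> (x + \<tau>) = \<psi> x" for \<tau> x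
  proof (rule least)
    fix w assume w: "w \<in> ?P"
    have "viscosity_subsolution F c (\<lambda>x. w (x + \<tau>))"
      using subsolution_rescale[OF PD(2)[OF w], of 1 \<tau> 0] that(1) by simp
    moreover have "continuous_on UNIV (\<lambda>x. w (x + \<tau>))"
      by (rule continuous_on_compose2[OF PD(1)[OF w]]) (auto intro!: continuous_intros)
    moreover have "v x \<le> w (x + \<tau>) \<and> w (x + \<tau>) \<le> \<psi> x" for x
      using PD(3,4)[OF w, of "x + \<tau>"] that(2,3)[of x] by simp
    ultimately have "(\<lambda>x. w (x + \<tau>)) \<in> ?P" by (simp add: perron_family_def)
    from upper[OF this, of x] show "w (x + \<tau>) \<le> u x" .
  qed
  show thesis
  proof (rule that[of u])
    show "viscosity_solution F c u" using u sub super by (simp add: viscosity_solution_def)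
    show "w x \<le> u x" if "continuous_on UNIV w" "viscosity_subsolution F c w" "\<And>x. v x \<le> w x"
      "\<And>x. w x \<le> \<psi> x" for w x
      by (rule upper) (use that in \<open>auto simp: perron_family_def\<close>)
    show "u (x + \<tau>) = u x"
      if "\<And>x p s. F (x + \<tau>) p s = F x p s" "\<And>x. v (x + \<tau>) = v x" "\<And>x. \<psi> (x + \<tau>) = \<psi> x" for \<tau> x
    proof (rule antisym)
      show "u (x + \<tau>) \<le> u x" by (rule shift) (rule that)+
      have "u (x + \<tau> + (- \<tau>)) \<le> u (x + \<tau>)"
      proof (rule shift)
        show "F (x + (- \<tau>)) p s = F x p s" for x p s using that(1)[of "x - \<tau>"] by simp
        show "v (x + (- \<tau>)) = v x" for x using that(2)[of "x - \<tau>"] by simp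
        show "\<psi> (x + (- \<tau>)) = \<psi> x" for x using that(3)[of "x - \<tau>"] by simp
      qed
      then show "u x \<le> u (x + \<tau>)" by simp
    qed
  qed (use vu u\<psi> in auto)
qed

section \<open>Periodic functions and comparison\<close>

lemma periodicD:
  assumes "lattice_periodic \<epsilon> f" "\<And>i. k $ i \<in> \<int>"
  shows "f (x + \<epsilon> *\<^sub>R k) = f x"
  using assms unfolding lattice_periodic_def by blast

text \<open>
  The closed cube is used, not a half-open one, for the sake of compactness; representatives of
  boundary points are then not unique, which is harmless.
\<close>

definition cell :: "real \<Rightarrow> (real^'n) set" where
  "cell \<epsilon> = cbox 0 (\<chi> i. \<epsilon>)"

lemma cell_representative:
  assumes "0 < \<epsilon>"
  obtains k :: "real^'n" where "\<And>i. k $ i \<in> \<int>" "x + \<epsilon> *\<^sub>R k \<in> cell \<epsilon>"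
proof
  define k :: "real^'n" where "k = (\<chi> i. - of_int \<lfloor>x $ i / \<epsilon>\<rfloor>)"
  show "k $ i \<in> \<int>" for i by (simp add: k_def)
  have "0 \<le> x $ i + \<epsilon> * - of_int \<lfloor>x $ i / \<epsilon>\<rfloor>" "x $ i + \<epsilon> * - of_int \<lfloor>x $ i / \<epsilon>\<rfloor> \<le> \<epsilon>" for i
  proof -
    have "of_int \<lfloor>x $ i / \<epsilon>\<rfloor> \<le> x $ i / \<epsilon>" "x $ i / \<epsilon> \<le> of_int \<lfloor>x $ i / \<epsilon>\<rfloor> + 1"
      by linarith+
    from this[THEN mult_left_mono, of \<epsilon>] assms
    show "0 \<le> x $ i + \<epsilon> * - of_int \<lfloor>x $ i / \<epsilon>\<rfloor>" "x $ i + \<epsilon> * - of_int \<lfloor>x $ i / \<epsilon>\<rfloor> \<le> \<epsilon>"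
      by (simp_all add: algebra_simps)
  qed
  then show "x + \<epsilon> *\<^sub>R k \<in> cell \<epsilon>"
    unfolding cell_def mem_box_cart by (simp add: k_def)
qed

lemma compact_cell: "compact (cell \<epsilon>)"
  by (simp add: cell_def)

lemma cell_nonempty: "0 < \<epsilon> \<Longrightarrow> cell \<epsilon> \<noteq> ({} :: (real^'n) set)"
  using cell_representative[of \<epsilon> "0 :: real^'n"] by blast

lemma periodic_bounded:
  fixes u :: "real^'n \<Rightarrow> real"
  assumes "lattice_periodic \<epsilon> u" "continuous_on UNIV u" "0 < \<epsilon>"
  obtains B where "\<And>x. \<bar>u x\<bar> \<le> B"
proof -
  have "bounded (u ` cell \<epsilon>)"
    by (intro compact_imp_bounded compact_continuous_image compact_cell continuous_on_subset[OF assms(2)]) auto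
  then obtain B where B: "\<And>x. x \<in> cell \<epsilon> \<Longrightarrow> \<bar>u x\<bar> \<le> B"
    unfolding bounded_iff by auto
  have "\<bar>u x\<bar> \<le> B" for x
  proof -
    obtain k where "\<And>i. k $ i \<in> \<int>" "x + \<epsilon> *\<^sub>R k \<in> cell \<epsilon>" using cell_representative assms(3) by metis
    then show ?thesis using B periodicD[OF assms(1)] by metis
  qed
  then show thesis by (rule that)
qed

lemma periodic_lipschitz_oscillation:
  fixes u :: "real^'n \<Rightarrow> real"
  assumes "lattice_periodic 1 u" "\<And>x y. u y - u x \<le> K * norm (y - x)" "0 < K"
  shows "u y - u x \<le> K * diameter (cell 1 :: (real^'n) set)"
proof -
  obtain k where k: "\<And>i. k $ i \<in> \<int>" "x + 1 *\<^sub>R k \<in> cell 1" using cell_representative[of 1 x] by auto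
  obtain l where l: "\<And>i. l $ i \<in> \<int>" "y + 1 *\<^sub>R l \<in> cell 1" using cell_representative[of 1 y] by auto
  have "u y - u x = u (y + 1 *\<^sub>R l) - u (x + 1 *\<^sub>R k)"
    using periodicD[OF assms(1)] k(1) l(1) by metis
  also have "\<dots> \<le> K * norm ((y + 1 *\<^sub>R l) - (x + 1 *\<^sub>R k))" by (rule assms)
  also have "\<dots> \<le> K * diameter (cell 1 :: (real^'n) set)"
    using diameter_bounded_bound[OF compact_imp_bounded[OF compact_cell] l(2) k(2)] assms(3)
    by (simp add: dist_norm)
  finally show ?thesis .
qed

text \<open>
  Doubling of variables.  At a maximum of \<open>u x - v y - norm (x - y)^2 / (2 \<delta>)\<close> both equations see
  the same gradient \<open>p\<close>, and the Lipschitz bound for \<open>u\<close> keeps \<open>norm (x - y)\<close> of order \<open>\<delta>\<close> and \<open>p\<close>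
  bounded.  If \<open>u\<close> exceeded \<open>v\<close> somewhere, then monotonicity in the value and uniform continuity
  of \<open>F\<close> would bring the levels \<open>c\<^sub>1\<close> and \<open>c\<^sub>2\<close> arbitrarily close.
\<close>

theorem comparison:
  fixes F :: "real^'n \<Rightarrow> real^'n \<Rightarrow> real \<Rightarrow> real"
  assumes F: "continuous_on UNIV (\<lambda>(x, p, s). F x p s)"
    and mono: "\<And>x p s t. s \<le> t \<Longrightarrow> F x p s \<le> F x p t"
    and \<epsilon>: "0 < \<epsilon>"
    and u: "continuous_on UNIV u" "lattice_periodic \<epsilon> u" "viscosity_subsolution F c\<^sub>1 u"
    and v: "continuous_on UNIV v" "lattice_periodic \<epsilon> v" "viscosity_supersolution F c\<^sub>2 v"
    and K: "0 < K" "\<And>x p. F x p (u x) \<le> c\<^sub>1 \<Longrightarrow> norm p < K"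
    and lt: "c\<^sub>1 < c\<^sub>2"
  shows "u x \<le> v x"
proof (rule ccontr)
  assume neg: "\<not> u x \<le> v x"
  obtain B where B: "\<And>x. \<bar>u x\<bar> \<le> B" using periodic_bounded[OF u(2,1) \<epsilon>] by blast
  obtain B' where B': "\<And>x. \<bar>v x\<bar> \<le> B'" using periodic_bounded[OF v(2,1) \<epsilon>] by blast
  have lip: "u y - u x \<le> K * norm (y - x)" for x y
    by (rule subsolution_lipschitz[OF u(1) B u(3) K])
  define R where "R = {a + b |a b. a \<in> cell \<epsilon> \<and> b \<in> cball (0 :: real^'n) 1} \<times> cball (0 :: real^'n) K \<times> cball (0::real) B"
  have "compact R"
    unfolding R_def by (intro compact_Times compact_sums compact_cell compact_cball)
  then have "uniformly_continuous_on R (\<lambda>(x, p, s). F x p s)"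
    by (intro compact_uniformly_continuous continuous_on_subset[OF F]) auto
  then obtain d where d: "d > 0" "\<And>z z'. z \<in> R \<Longrightarrow> z' \<in> R \<Longrightarrow> dist z' z < d \<Longrightarrow>
     dist ((\<lambda>(x, p, s). F x p s) z') ((\<lambda>(x, p, s). F x p s) z) < c\<^sub>2 - c\<^sub>1"
    using lt unfolding uniformly_continuous_on_def by (metis diff_gt_0_iff_gt)
  define \<delta> where "\<delta> = min 1 (d/2) / (2 * K)"
  have \<delta>: "\<delta> > 0" "2 * K * \<delta> \<le> 1" "2 * K * \<delta> < d" using K d by (auto simp: \<delta>_def field_simps)
  \<comment> \<open>In the variables \<open>x\<close> and \<open>z = y - x\<close> the penalized difference is periodic in \<open>x\<close>, and
      large \<open>z\<close> are excluded by the penalty, so that a maximum exists.\<close>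
  define f where "f = (\<lambda>(x, z). u x - v (x + z) - (norm z)\<^sup>2 / (2 * \<delta>))"
  have fcont: "continuous_on S f" for S
    unfolding f_def case_prod_beta
    by (intro continuous_intros continuous_on_compose2[OF u(1)] continuous_on_compose2[OF v(1)]) (use \<delta> in auto)
  define r where "r = sqrt (2 * \<delta> * (2 * B + 2 * B'))"
  have BB: "0 \<le> B" "0 \<le> B'" using B[of 0] B'[of 0] by linarith+
  have r: "0 \<le> r" "r\<^sup>2 = 2 * \<delta> * (2 * B + 2 * B')" using BB \<delta> by (auto simp: r_def)
  have "compact (cell \<epsilon> \<times> cball (0 :: real^'n) r)"
    by (intro compact_Times compact_cell compact_cball)
  moreover have "cell \<epsilon> \<times> cball (0 :: real^'n) r \<noteq> {}" using cell_nonempty[OF \<epsilon>] r by auto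
  ultimately obtain m where m: "m \<in> cell \<epsilon> \<times> cball 0 r"
    "\<And>z. z \<in> cell \<epsilon> \<times> cball 0 r \<Longrightarrow> f z \<le> f m"
    using continuous_attains_sup[OF _ _ fcont] by metis
  obtain x0 z0 where m': "m = (x0, z0)" by (cases m)
  have max: "f (x, z) \<le> f (x0, z0)" for x z
  proof -
    obtain k where k: "\<And>i. k $ i \<in> \<int>" "x + \<epsilon> *\<^sub>R k \<in> cell \<epsilon>" using cell_representative \<epsilon> by metis
    have shift: "f (x, z) = f (x + \<epsilon> *\<^sub>R k, z)"
    proof -
      have "x + \<epsilon> *\<^sub>R k + z = (x + z) + \<epsilon> *\<^sub>R k" by simp
      then show ?thesis unfolding f_def using periodicD[OF u(2) k(1)] periodicD[OF v(2) k(1)] by (simp only: split_conv)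
    qed
    show ?thesis
    proof (cases "norm z \<le> r")
      case True
      then show ?thesis using m(2)[of "(x + \<epsilon> *\<^sub>R k, z)"] k shift m' by simp
    next
      case False
      then have "r\<^sup>2 < (norm z)\<^sup>2" using r by (intro power_strict_mono) auto
      then have "2 * B + 2 * B' \<le> (norm z)\<^sup>2 / (2 * \<delta>)" using r \<delta> by (simp add: field_simps)
      then have "f (x, z) \<le> f (x + \<epsilon> *\<^sub>R k, 0)"
        using B[of x] B'[of "x + z"] B[of "x + \<epsilon> *\<^sub>R k"] B'[of "x + \<epsilon> *\<^sub>R k"]
        unfolding f_def by simp
      also have "\<dots> \<le> f (x0, z0)" using m(2)[of "(x + \<epsilon> *\<^sub>R k, 0)"] k r m' by simp
      finally show ?thesis .
    qed
  qed
  define y0 where "y0 = x0 + z0"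
  define p where "p = (1 / \<delta>) *\<^sub>R (x0 - y0)"
  have f_eq: "f (x, y - x) = u x - v y - (norm (x - y))\<^sup>2 / (2 * \<delta>)" for x y
    by (simp add: f_def norm_minus_commute)
  have max': "u x - v y - (norm (x - y))\<^sup>2 / (2 * \<delta>) \<le> u x0 - v y0 - (norm (x0 - y0))\<^sup>2 / (2 * \<delta>)" for x y
    using max[of x "y - x"] f_eq[of x y] f_eq[of x0 y0] by (simp add: y0_def)
  have pos: "v y0 < u x0"
  proof -
    have "0 \<le> (norm (x0 - y0))\<^sup>2 / (2 * \<delta>)" using \<delta> by simp
    then show ?thesis using max'[of x x] neg by simp
  qed
  have near: "norm (x0 - y0) \<le> 2 * \<delta> * K"
  proof (cases "norm (x0 - y0) = 0")
    case False
    have "(norm (x0 - y0))\<^sup>2 / (2 * \<delta>) \<le> u x0 - u y0" using max'[of y0 y0] by simp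
    also have "\<dots> \<le> K * norm (x0 - y0)" by (rule lip)
    finally have "norm (x0 - y0) * norm (x0 - y0) \<le> (2 * \<delta> * K) * norm (x0 - y0)"
      using \<delta> by (simp add: field_simps power2_eq_square)
    then show ?thesis using False by (simp add: mult_le_cancel_right)
  qed (use \<delta> K in simp)
  have "\<forall>\<^sub>F x in nhds x0. u x - (0 + (1 / (2 * \<delta>)) * (norm (x - y0))\<^sup>2) \<le> u x0 - (0 + (1 / (2 * \<delta>)) * (norm (x0 - y0))\<^sup>2)"
    by (rule always_eventually) (use max'[of _ y0] in auto)
  from subsolutionD[OF u(3) C1_paraboloid this] have 1: "F x0 p (u x0) \<le> c\<^sub>1"
    by (simp add: p_def)
  have "\<forall>\<^sub>F y in nhds y0. v y0 - (0 + (- 1 / (2 * \<delta>)) * (norm (y0 - x0))\<^sup>2) \<le> v y - (0 + (- 1 / (2 * \<delta>)) * (norm (y - x0))\<^sup>2)"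
  proof (rule always_eventually, rule allI)
    fix y show "v y0 - (0 + (- 1 / (2 * \<delta>)) * (norm (y0 - x0))\<^sup>2) \<le> v y - (0 + (- 1 / (2 * \<delta>)) * (norm (y - x0))\<^sup>2)"
      using max'[of x0 y] by (simp add: norm_minus_commute)
  qed
  from supersolutionD[OF v(3) C1_paraboloid this]
  have "c\<^sub>2 \<le> F y0 ((2 * (- 1 / (2 * \<delta>))) *\<^sub>R (y0 - x0)) (v y0)" .
  also have "(2 * (- 1 / (2 * \<delta>))) *\<^sub>R (y0 - x0) = p"
    using \<delta> by (simp add: p_def algebra_simps)
  also have "F y0 p (v y0) \<le> F y0 p (u x0)" using pos by (intro mono) simp
  finally have 2: "c\<^sub>2 \<le> F y0 p (u x0)" .
  have pK: "norm p < K" using 1 by (rule K)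
  have x0: "x0 \<in> cell \<epsilon>" using m(1) m' by simp
  have in_R: "(x0 + z, p, u x0) \<in> R" if "norm z \<le> 1" for z
  proof -
    have "z \<in> cball 0 1" using that by simp
    then have "x0 + z \<in> {a + b |a b. a \<in> cell \<epsilon> \<and> b \<in> cball (0 :: real^'n) 1}"
      using x0 by blast
    then show ?thesis using pK B[of x0] by (simp add: R_def)
  qed
  have "(x0, p, u x0) \<in> R" using in_R[of 0] by simp
  moreover have "(y0, p, u x0) \<in> R"
    unfolding y0_def by (rule in_R) (use near \<delta> in \<open>simp add: y0_def mult_ac\<close>)
  moreover have "dist (y0, p, u x0) (x0, p, u x0) < d"
    using near \<delta>(3) by (simp add: dist_Pair_Pair dist_norm norm_minus_commute mult_ac)
  ultimately have "dist (F y0 p (u x0)) (F x0 p (u x0)) < c\<^sub>2 - c\<^sub>1"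
    using d(2)[of "(x0, p, u x0)" "(y0, p, u x0)"] by simp
  then show False using 1 2 by (simp add: dist_real_def)
qed

section \<open>The cell problem\<close>

text \<open>
  Convexity and superlinear growth are represented by the coercivity that they imply.  It is uniform
  in \<open>x\<close> by periodicity, and by monotonicity a bound for one \<open>\<theta>\<close> holds for all larger values too, so
  it suffices to assume it for each \<open>\<theta>\<close> separately.
\<close>

locale monotone_coercive_hamiltonian =
  fixes H :: "real^'n \<Rightarrow> real^'n \<Rightarrow> real \<Rightarrow> real"
  assumes periodic: "lattice_periodic 1 (\<lambda>x. H x p \<theta>)"
    and cont: "continuous_on UNIV (\<lambda>(x, p, \<theta>). H x p \<theta>)"
    and mono: "s \<le> t \<Longrightarrow> H x p s \<le> H x p t"
    and coercive: "\<exists>K>0. \<forall>x p. H x p \<theta> \<le> M \<longrightarrow> norm p < K"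
begin

abbreviation "cell_op p \<theta> \<equiv> (\<lambda>x q (_::real). H x (p + q) \<theta>)"

lemma H_shift: "(\<And>i. k $ i \<in> \<int>) \<Longrightarrow> H (x + k) p \<theta> = H x p \<theta>"
  using periodicD[OF periodic, of k x p \<theta>] by simp

lemma continuous_on_H:
  assumes "continuous_on S f" "continuous_on S g" "continuous_on S h"
  shows "continuous_on S (\<lambda>z. H (f z) (g z) (h z))"
proof -
  have "continuous_on S (\<lambda>z. (\<lambda>(x, p, \<theta>). H x p \<theta>) (f z, g z, h z))"
    by (rule continuous_on_compose2[OF cont]) (auto intro!: continuous_intros assms)
  then show ?thesis by simp
qed

lemma cell_op_cont: "continuous_on UNIV (\<lambda>(x, q, s). cell_op p \<theta> x q s)"
  unfolding case_prod_beta by (intro continuous_on_H continuous_intros)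

lemma cell_op_coercive: "\<exists>K>0. \<forall>x q. H x (p + q) \<theta> \<le> M \<longrightarrow> norm q < K"
proof -
  obtain K where K: "K > 0" "\<And>x q. H x q \<theta> \<le> M \<Longrightarrow> norm q < K" using coercive by metis
  have "norm q < K + norm p" if "H x (p + q) \<theta> \<le> M" for x q
    using K(2)[OF that] norm_triangle_ineq4[of "p + q" p] by simp
  then show ?thesis using K(1) by (intro exI[of _ "K + norm p"]) (auto intro: add_pos_nonneg)
qed

lemma H_bounded: obtains M where "\<And>x. \<bar>H x p \<theta>\<bar> \<le> M"
proof -
  have "continuous_on UNIV (\<lambda>x. H x p \<theta>)" by (intro continuous_on_H continuous_intros)
  from periodic_bounded[OF periodic this] that show thesis by auto
qed

text \<open>
  The cell problem does not see additive constants.  If \<open>c\<^sub>1 < c\<^sub>2\<close>, the comparison principle would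
  apply to every vertical translate of \<open>u\<close>, also to those that exceed \<open>v\<close>.
\<close>

lemma cell_values_ordered:
  assumes u: "lattice_periodic 1 u" "continuous_on UNIV u" "viscosity_subsolution (cell_op p \<theta>) c\<^sub>1 u"
    and v: "lattice_periodic 1 v" "continuous_on UNIV v" "viscosity_supersolution (cell_op p \<theta>) c\<^sub>2 v"
  shows "c\<^sub>2 \<le> c\<^sub>1"
proof (rule ccontr)
  assume "\<not> c\<^sub>2 \<le> c\<^sub>1"
  then have lt: "c\<^sub>1 < c\<^sub>2" by simp
  obtain K where K: "K > 0" "\<And>x q. H x (p + q) \<theta> \<le> c\<^sub>1 \<Longrightarrow> norm q < K"
    using cell_op_coercive by metis
  define k where "k = v 0 - u 0 + 1"
  have "k + u 0 \<le> v 0"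
  proof (rule comparison[OF cell_op_cont])
    show "viscosity_subsolution (cell_op p \<theta>) c\<^sub>1 (\<lambda>x. k + u x)"
      using subsolution_rescale[OF u(3), of 1 0 k] by simp
    show "lattice_periodic 1 (\<lambda>x. k + u x)" using u(1) by (auto simp: lattice_periodic_def)
    show "continuous_on UNIV (\<lambda>x. k + u x)" by (intro continuous_intros u)
  qed (use v K lt in auto)
  then show False by (simp add: k_def)
qed

text \<open>
  The constants \<open>- M / \<mu>\<close> and \<open>M / \<mu>\<close> are a subsolution and a supersolution.
\<close>

lemma discounted_solution:
  assumes M: "\<And>x. \<bar>H x p \<theta>\<bar> \<le> M" and \<mu>: "0 < \<mu>"
  shows "\<exists>u. lattice_periodic 1 u \<and> viscosity_solution (\<lambda>x q s. H x (p + q) \<theta> + \<mu> * s) 0 u \<and>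
    (\<forall>x. \<bar>\<mu> * u x\<bar> \<le> M)"
proof -
  have M0: "0 \<le> M" using M[of 0] by linarith
  obtain K where K: "K > 0" "\<And>x q. H x (p + q) \<theta> \<le> M \<Longrightarrow> norm q < K"
    using cell_op_coercive by metis
  let ?F = "\<lambda>x q s. H x (p + q) \<theta> + \<mu> * s"
  have F: "continuous_on UNIV (\<lambda>(x, q, s). ?F x q s)"
    unfolding case_prod_beta by (intro continuous_on_H continuous_intros)
  have v: "viscosity_subsolution ?F 0 (\<lambda>x. - (M / \<mu>))"
  proof (rule constant_subsolution)
    show "H x (p + 0) \<theta> + \<mu> * - (M / \<mu>) \<le> 0" for x using M[of x] \<mu> by (simp add: abs_le_iff)
  qed
  have \<psi>: "viscosity_supersolution ?F 0 (\<lambda>x. M / \<mu>)"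
  proof (rule constant_supersolution)
    show "0 \<le> H x (p + 0) \<theta> + \<mu> * (M / \<mu>)" for x using M[of x] \<mu> by (simp add: abs_le_iff)
  qed
  have co: "norm q < K" if "- (M / \<mu>) \<le> s" "?F x q s \<le> 0" for x q s
  proof (rule K(2))
    have "- M \<le> \<mu> * s" using that(1) \<mu> by (simp add: field_simps)
    then show "H x (p + q) \<theta> \<le> M" using that(2) by linarith
  qed
  have le: "- (M / \<mu>) \<le> M / \<mu>" using M0 \<mu> by (simp add: field_simps)
  show ?thesis
  proof (rule perron[OF F continuous_on_const v continuous_on_const \<psi> le order_refl order_refl co K(1)])
    fix u
    assume u: "viscosity_solution ?F 0 u" "\<And>x. - (M / \<mu>) \<le> u x" "\<And>x. u x \<le> M / \<mu>"
      and shift: "\<And>\<tau> x. (\<And>x q s. ?F (x + \<tau>) q s = ?F x q s) \<Longrightarrow> (\<And>x. - (M / \<mu>) = - (M / \<mu>)) \<Longrightarrow>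
        (\<And>x. M / \<mu> = M / \<mu>) \<Longrightarrow> u (x + \<tau>) = u x"
    have "lattice_periodic 1 u"
      unfolding lattice_periodic_def by (intro allI impI shift refl) (simp add: H_shift)
    moreover have "\<bar>\<mu> * u x\<bar> \<le> M" for x
      using u(2,3)[of x] \<mu> by (simp add: abs_le_iff field_simps)
    ultimately show ?thesis using u(1) by blast
  qed
qed

text \<open>
  Vanishing discount.  Since \<open>\<mu> u\<close> is bounded by \<open>M\<close> uniformly in \<open>\<mu>\<close>, the discounted solutions are
  equi-Lipschitz and, being periodic, their oscillation is bounded as well.  Thus \<open>u - u 0\<close> converges
  uniformly along a subsequence by the theorem of Arzela and Ascoli, while \<open>\<mu> u\<close> becomes constant in
  the limit; this constant is \<open>-c\<close>.
\<close>

lemma cell_solution_exists: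
  "\<exists>c u. lattice_periodic 1 u \<and> viscosity_solution (cell_op p \<theta>) c u"
proof -
  obtain M where M: "\<And>x. \<bar>H x p \<theta>\<bar> \<le> M" using H_bounded by metis
  obtain K where K: "K > 0" "\<And>x q. H x (p + q) \<theta> \<le> M \<Longrightarrow> norm q < K"
    using cell_op_coercive by metis
  define l :: "nat \<Rightarrow> real" where "l n = inverse (real (Suc n))" for n
  have l: "l n > 0" for n by (simp add: l_def)
  have "\<forall>n. \<exists>u. lattice_periodic 1 u \<and> viscosity_solution (\<lambda>x q s. H x (p + q) \<theta> + l n * s) 0 u \<and>
    (\<forall>x. \<bar>l n * u x\<bar> \<le> M)"
    using discounted_solution[OF M l] by blast
  then obtain u where u: "\<And>n. lattice_periodic 1 (u n)"
    "\<And>n. viscosity_solution (\<lambda>x q s. H x (p + q) \<theta> + l n * s) 0 (u n)"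
    "\<And>n x. \<bar>l n * u n x\<bar> \<le> M"
    by metis
  have uc: "continuous_on UNIV (u n)" for n using u(2) by (simp add: viscosity_solution_def)
  define D where "D = K * diameter (cell 1 :: (real^'n) set)"
  have lip: "u n y - u n x \<le> K * norm (y - x)" for n x y
  proof -
    obtain B where B: "\<And>x. \<bar>u n x\<bar> \<le> B" using periodic_bounded[OF u(1) uc] by auto
    have sub: "viscosity_subsolution (cell_op p \<theta>) M (u n)"
    proof (rule subsolution_weaken)
      show "viscosity_subsolution (\<lambda>x q s. H x (p + q) \<theta> + l n * s) 0 (u n)"
        using u(2) by (simp add: viscosity_solution_def)
      show "H x (p + q) \<theta> \<le> M" if "H x (p + q) \<theta> + l n * u n x \<le> 0" for x q
        using that u(3)[of n x] by linarith
    qed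
    show ?thesis by (rule subsolution_lipschitz[OF uc B sub K(1)]) (rule K(2))
  qed
  define v where "v n x = u n x - u n 0" for n x
  have vper: "v n (x + 1 *\<^sub>R k) = v n x" if "\<And>i. k $ i \<in> \<int>" for n x k
    unfolding v_def using periodicD[OF u(1) that] by metis
  have vlip: "\<bar>v n y - v n x\<bar> \<le> K * norm (y - x)" for n x y
    using lip[of n y x] lip[of n x y] unfolding v_def by (simp add: norm_minus_commute abs_le_iff)
  have vD: "\<bar>v n x\<bar> \<le> D" for n x
    using periodic_lipschitz_oscillation[OF u(1) lip K(1), of n x 0]
      periodic_lipschitz_oscillation[OF u(1) lip K(1), of n 0 x]
    unfolding v_def D_def by (simp add: abs_le_iff)
  obtain g k where g: "strict_mono (k :: nat \<Rightarrow> nat)"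
    "\<And>e. 0 < e \<Longrightarrow> \<exists>N. \<forall>n x. n \<ge> N \<and> x \<in> cell 1 \<longrightarrow> norm (v (k n) x - g x) < e"
  proof (rule Arzela_Ascoli[OF compact_cell[of 1], of v D])
    show "norm (v n x) \<le> D" for n x using vD by simp
    fix x :: "real^'n" and e :: real assume "0 < e"
    have "norm (v n x - v n y) < e" if "norm (x - y) < e / K" for n y
    proof -
      have "norm (v n x - v n y) \<le> K * norm (x - y)" using vlip[of n x y] by simp
      also have "\<dots> < e" using that K by (simp add: field_simps)
      finally show ?thesis .
    qed
    then show "\<exists>d>0. \<forall>n y. y \<in> cell 1 \<and> norm (x - y) < d \<longrightarrow> norm (v n x - v n y) < e"
      using \<open>0 < e\<close> K by (intro exI[of _ "e / K"]) auto
  qed (rule that)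
  \<comment> \<open>Uniform convergence is only given on the closed cell; by periodicity it extends to the whole
      space once each point is moved into the cell by a chosen lattice vector \<open>\<kappa> x\<close>.\<close>
  have "\<forall>x :: real^'n. \<exists>\<kappa>. (\<forall>i. \<kappa> $ i \<in> \<int>) \<and> x + 1 *\<^sub>R \<kappa> \<in> cell 1"
    using cell_representative[of 1] by (metis zero_less_one)
  then obtain \<kappa> :: "real^'n \<Rightarrow> real^'n" where \<kappa>: "\<And>x i. \<kappa> x $ i \<in> \<int>" "\<And>x. x + 1 *\<^sub>R \<kappa> x \<in> cell 1"
    by metis
  define w where "w x = g (x + 1 *\<^sub>R \<kappa> x)" for x
  have vw: "\<exists>N. \<forall>n\<ge>N. \<forall>x. \<bar>v (k n) x - w x\<bar> < e" if e: "e > 0" for e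
  proof -
    obtain N where N: "\<forall>n x. n \<ge> N \<and> x \<in> cell 1 \<longrightarrow> norm (v (k n) x - g x) < e" using g(2)[OF e] by blast
    have "\<bar>v (k n) x - w x\<bar> < e" if "n \<ge> N" for n x
    proof -
      have "norm (v (k n) (x + 1 *\<^sub>R \<kappa> x) - g (x + 1 *\<^sub>R \<kappa> x)) < e" using N that \<kappa>(2) by blast
      then show ?thesis unfolding vper[OF \<kappa>(1)] w_def by simp
    qed
    then show ?thesis by blast
  qed
  have wlip: "w y - w x \<le> K * norm (y - x)" for x y
  proof (rule field_le_epsilon)
    fix e :: real assume "e > 0"
    then obtain N where "\<forall>n\<ge>N. \<forall>x. \<bar>v (k n) x - w x\<bar> < e/2" using vw[of "e/2"] by auto
    then have "\<bar>v (k N) x - w x\<bar> < e/2" "\<bar>v (k N) y - w y\<bar> < e/2" by auto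
    then show "w y - w x \<le> K * norm (y - x) + e" using vlip[of "k N" y x] by linarith
  qed
  have wper: "lattice_periodic 1 w"
    unfolding lattice_periodic_def
  proof (intro allI impI)
    fix x j :: "real^'n" assume j: "\<forall>i. j $ i \<in> \<int>"
    have "\<bar>w (x + 1 *\<^sub>R j) - w x\<bar> \<le> 0"
    proof (rule field_le_epsilon)
      fix e :: real assume "e > 0"
      then obtain N where "\<forall>n\<ge>N. \<forall>x. \<bar>v (k n) x - w x\<bar> < e/2" using vw[of "e/2"] by auto
      then have "\<bar>v (k N) (x + 1 *\<^sub>R j) - w (x + 1 *\<^sub>R j)\<bar> < e/2" "\<bar>v (k N) x - w x\<bar> < e/2" by blast+
      moreover have "v (k N) (x + 1 *\<^sub>R j) = v (k N) x" using j by (intro vper) blast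
      ultimately show "\<bar>w (x + 1 *\<^sub>R j) - w x\<bar> \<le> 0 + e" by linarith
    qed
    then show "w (x + 1 *\<^sub>R j) = w x" by simp
  qed
  have wc: "continuous_on UNIV w" using wlip K(1) by (rule lipschitz_continuous)
  define a where "a n = l (k n) * u (k n) 0" for n
  have "\<forall>n. a n \<in> cball 0 M" using u(3) by (simp add: a_def)
  then obtain c' r where r: "strict_mono (r :: nat \<Rightarrow> nat)" "(a \<circ> r) \<longlonglongrightarrow> c'"
    using compact_imp_seq_compact[OF compact_cball] unfolding seq_compact_def by metis
  define j where "j = k \<circ> r"
  have j: "strict_mono j" unfolding j_def using g(1) r(1) by (rule strict_mono_o)
  have "l \<longlonglongrightarrow> 0" unfolding l_def by (rule LIMSEQ_inverse_real_of_nat)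
  then have "(\<lambda>n. l (j n) * D) \<longlonglongrightarrow> 0 * D"
    using LIMSEQ_subseq_LIMSEQ[OF _ j] by (intro tendsto_intros) (auto simp: o_def)
  then have lD: "(\<lambda>n. l (j n) * D) \<longlonglongrightarrow> 0" by simp
  define c where "c = - c'"
  have close: "\<exists>n. (\<forall>x. \<bar>v (j n) x - w x\<bar> < e) \<and> (\<forall>x. \<bar>l (j n) * u (j n) x + c\<bar> \<le> e)" if e: "e > 0" for e
  proof -
    obtain N1 where N1: "\<forall>n\<ge>N1. \<forall>x. \<bar>v (k n) x - w x\<bar> < e" using vw[OF e] by blast
    obtain N2 where N2: "\<forall>n\<ge>N2. dist ((a \<circ> r) n) c' < e/2"
      using r(2) e unfolding lim_sequentially by (meson half_gt_zero)
    obtain N3 where N3: "\<forall>n\<ge>N3. dist (l (j n) * D) 0 < e/2"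
      using lD e unfolding lim_sequentially by (meson half_gt_zero)
    define n where "n = max N1 (max N2 N3)"
    have "r n \<ge> N1" using seq_suble[OF r(1), of n] by (simp add: n_def)
    then have "\<forall>x. \<bar>v (j n) x - w x\<bar> < e" using N1 by (simp add: j_def)
    moreover have "\<bar>l (j n) * u (j n) x + c\<bar> \<le> e" for x
    proof -
      have "\<bar>l (j n) * u (j n) 0 + c\<bar> < e/2"
        using N2 by (auto simp: n_def a_def j_def c_def dist_real_def)
      moreover have "\<bar>l (j n) * v (j n) x\<bar> \<le> l (j n) * D"
        using mult_left_mono[OF vD[of "j n" x], of "l (j n)"] l[of "j n"] by (simp add: abs_mult)
      moreover have "dist (l (j n) * D) 0 < e/2" using N3 by (simp add: n_def)
      then have "l (j n) * D < e/2" unfolding dist_real_def by linarith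
      moreover have "l (j n) * u (j n) x = l (j n) * u (j n) 0 + l (j n) * v (j n) x"
        by (simp add: v_def algebra_simps)
      ultimately show ?thesis by linarith
    qed
    ultimately show ?thesis by blast
  qed
  have vc: "continuous_on UNIV (v n)" for n
    unfolding v_def by (intro continuous_intros uc)
  have "viscosity_subsolution (cell_op p \<theta>) c w"
  proof (rule subsolution_stability[OF cell_op_cont wc])
    fix x :: "real^'n" and e \<rho> :: real assume e: "0 < e"
    obtain n where n: "\<And>x. \<bar>v (j n) x - w x\<bar> < e" "\<And>x. \<bar>l (j n) * u (j n) x + c\<bar> \<le> e" using close[OF e] by blast
    have "viscosity_subsolution (cell_op p \<theta>) (c + e) (u (j n))"
    proof (rule subsolution_weaken)
      show "viscosity_subsolution (\<lambda>x q s. H x (p + q) \<theta> + l (j n) * s) 0 (u (j n))"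
        using u(2) by (simp add: viscosity_solution_def)
      show "H x (p + q) \<theta> \<le> c + e" if "H x (p + q) \<theta> + l (j n) * u (j n) x \<le> 0" for x q
        using that n(2)[of x] by linarith
    qed
    from subsolution_rescale[OF this, of 1 0 "- u (j n) 0"]
    have "viscosity_subsolution (cell_op p \<theta>) (c + e) (v (j n))" by (simp add: v_def[abs_def])
    moreover have "v (j n) y \<le> w y + e" "w y - e \<le> v (j n) y" for y using n(1)[of y] by linarith+
    ultimately show "\<exists>w'. continuous_on UNIV w' \<and> viscosity_subsolution (cell_op p \<theta>) (c + e) w' \<and>
           (\<forall>y\<in>cball x \<rho>. w' y \<le> w y + e) \<and> w x - e \<le> w' x" using vc by blast
  qed
  moreover have "viscosity_supersolution (cell_op p \<theta>) c w"
  proof (rule supersolution_stability[OF cell_op_cont wc])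
    fix x :: "real^'n" and e \<rho> :: real assume e: "0 < e"
    obtain n where n: "\<And>x. \<bar>v (j n) x - w x\<bar> < e" "\<And>x. \<bar>l (j n) * u (j n) x + c\<bar> \<le> e" using close[OF e] by blast
    have "viscosity_supersolution (cell_op p \<theta>) (c - e) (u (j n))"
    proof (rule supersolution_weaken)
      show "viscosity_supersolution (\<lambda>x q s. H x (p + q) \<theta> + l (j n) * s) 0 (u (j n))"
        using u(2) by (simp add: viscosity_solution_def)
      show "c - e \<le> H x (p + q) \<theta>" if "0 \<le> H x (p + q) \<theta> + l (j n) * u (j n) x" for x q
        using that n(2)[of x] by linarith
    qed
    from supersolution_rescale[OF this, of 1 0 "- u (j n) 0"]
    have "viscosity_supersolution (cell_op p \<theta>) (c - e) (v (j n))" by (simp add: v_def[abs_def])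
    moreover have "w y - e \<le> v (j n) y" "v (j n) y \<le> w y + e" for y using n(1)[of y] by linarith+
    ultimately show "\<exists>w'. continuous_on UNIV w' \<and> viscosity_supersolution (cell_op p \<theta>) (c - e) w' \<and>
           (\<forall>y\<in>cball x \<rho>. w y - e \<le> w' y) \<and> w' x \<le> w x + e" using vc by blast
  qed
  ultimately show ?thesis using wper wc unfolding viscosity_solution_def by blast
qed

section \<open>The effective Hamiltonian\<close>

abbreviation "Hbar \<equiv> effective_hamiltonian H"

lemma effective_solution:
  "\<exists>u. lattice_periodic 1 u \<and> viscosity_solution (cell_op p \<theta>) (Hbar p \<theta>) u"
proof -
  have "\<exists>!c. \<exists>u. lattice_periodic 1 u \<and> viscosity_solution (cell_op p \<theta>) c u"
  proof (rule ex_ex1I[OF cell_solution_exists])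
    fix c c' assume "\<exists>u. lattice_periodic 1 u \<and> viscosity_solution (cell_op p \<theta>) c u"
      "\<exists>u. lattice_periodic 1 u \<and> viscosity_solution (cell_op p \<theta>) c' u"
    then obtain u u' where "lattice_periodic 1 u" "viscosity_solution (cell_op p \<theta>) c u"
      "lattice_periodic 1 u'" "viscosity_solution (cell_op p \<theta>) c' u'" by blast
    then show "c = c'"
      using cell_values_ordered[of u' p \<theta> c' u c] cell_values_ordered[of u p \<theta> c u' c']
      unfolding viscosity_solution_def by auto
  qed
  from theI'[OF this] show ?thesis unfolding effective_hamiltonian_def .
qed

lemma Hbar_le:
  assumes "lattice_periodic 1 u" "continuous_on UNIV u" "viscosity_subsolution (cell_op p \<theta>) c u"
  shows "Hbar p \<theta> \<le> c"
  using effective_solution[of p \<theta>] cell_values_ordered[OF assms]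
  unfolding viscosity_solution_def by blast

lemma Hbar_le_bound:
  assumes "\<And>x. H x p \<theta> \<le> M" shows "Hbar p \<theta> \<le> M"
proof (rule Hbar_le)
  show "viscosity_subsolution (cell_op p \<theta>) M (\<lambda>x. 0)"
    by (rule constant_subsolution) (simp add: assms)
qed (auto simp: lattice_periodic_def)

lemma Hbar_mono:
  assumes "\<theta> \<le> \<theta>'" shows "Hbar p \<theta> \<le> Hbar p \<theta>'"
proof -
  obtain u where u: "lattice_periodic 1 u" "viscosity_solution (cell_op p \<theta>') (Hbar p \<theta>') u"
    using effective_solution by blast
  have "viscosity_subsolution (cell_op p \<theta>) (Hbar p \<theta>') u"
  proof (rule subsolution_weaken)
    show "viscosity_subsolution (cell_op p \<theta>') (Hbar p \<theta>') u"
      using u by (simp add: viscosity_solution_def)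
  qed (use mono[OF assms] order_trans in blast)
  then show ?thesis using u by (intro Hbar_le) (auto simp: viscosity_solution_def)
qed

text \<open>
  A solution of the cell problem at \<open>(p\<^sub>2, \<theta>\<^sub>2)\<close> is a subsolution at \<open>(p\<^sub>1, \<theta>\<^sub>1)\<close> up to the error \<open>e\<close>:
  coercivity confines the gradients that occur to a compact set, where \<open>H\<close> is uniformly continuous.
  The symmetric form in the two points gives both halves of continuity at once.
\<close>

lemma Hbar_locally_close:
  assumes e: "0 < e"
  shows "\<exists>d>0. \<forall>p\<^sub>1 p\<^sub>2 \<theta>\<^sub>1 \<theta>\<^sub>2. dist p\<^sub>1 p < d \<longrightarrow> dist p\<^sub>2 p < d \<longrightarrow> dist \<theta>\<^sub>1 \<theta> < d \<longrightarrow> dist \<theta>\<^sub>2 \<theta> < d \<longrightarrow>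
     Hbar p\<^sub>1 \<theta>\<^sub>1 \<le> Hbar p\<^sub>2 \<theta>\<^sub>2 + e"
proof -
  have "bounded ((\<lambda>(x, p, \<theta>). H x p \<theta>) ` (cell 1 \<times> cball p 1 \<times> cball \<theta> 1))"
    by (intro compact_imp_bounded compact_continuous_image compact_Times compact_cell compact_cball
        continuous_on_subset[OF cont]) auto
  then obtain M where M0: "\<And>z. z \<in> cell 1 \<times> cball p 1 \<times> cball \<theta> 1 \<Longrightarrow> \<bar>(\<lambda>(x, p, \<theta>). H x p \<theta>) z\<bar> \<le> M"
    unfolding bounded_iff by auto
  have shift: "\<exists>y\<in>cell 1. \<forall>q s. H x q s = H y q s" for x
  proof -
    obtain k where "\<And>i. k $ i \<in> \<int>" "x + 1 *\<^sub>R k \<in> cell 1" using cell_representative[of 1 x] by auto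
    then show ?thesis using H_shift by (intro bexI[of _ "x + 1 *\<^sub>R k"]) auto
  qed
  have M: "H x q s \<le> M" if "q \<in> cball p 1" "s \<in> cball \<theta> 1" for x q s
  proof -
    obtain y where y: "y \<in> cell 1" "H x q s = H y q s" using shift by blast
    then show ?thesis using M0[of "(y, q, s)"] that by auto
  qed
  obtain K where K: "K > 0" "\<And>x q. H x q (\<theta> - 1) \<le> M \<Longrightarrow> norm q < K" using coercive by metis
  define S where "S = (cell 1 :: (real^'n) set) \<times> cball (0 :: real^'n) (K + 2) \<times> cball \<theta> 1"
  have "compact S" unfolding S_def by (intro compact_Times compact_cell compact_cball)
  then have "uniformly_continuous_on S (\<lambda>(x, p, \<theta>). H x p \<theta>)"
    by (intro compact_uniformly_continuous continuous_on_subset[OF cont]) auto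
  then obtain d where d: "d > 0" "\<And>z z'. z \<in> S \<Longrightarrow> z' \<in> S \<Longrightarrow> dist z' z < d \<Longrightarrow>
     dist ((\<lambda>(x, p, \<theta>). H x p \<theta>) z') ((\<lambda>(x, p, \<theta>). H x p \<theta>) z) < e"
    using e unfolding uniformly_continuous_on_def by metis
  show ?thesis
  proof (intro exI[of _ "min 1 (d/4)"] conjI allI impI)
    fix p\<^sub>1 p\<^sub>2 \<theta>\<^sub>1 \<theta>\<^sub>2
    assume "dist p\<^sub>1 p < min 1 (d/4)" "dist p\<^sub>2 p < min 1 (d/4)"
      "dist \<theta>\<^sub>1 \<theta> < min 1 (d/4)" "dist \<theta>\<^sub>2 \<theta> < min 1 (d/4)"
    then have *: "dist p\<^sub>1 p < 1" "dist p\<^sub>2 p < 1" "dist \<theta>\<^sub>1 \<theta> < 1" "dist \<theta>\<^sub>2 \<theta> < 1"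
      "dist p\<^sub>1 p < d/4" "dist p\<^sub>2 p < d/4" "dist \<theta>\<^sub>1 \<theta> < d/4" "dist \<theta>\<^sub>2 \<theta> < d/4" by auto
    obtain u where u: "lattice_periodic 1 u" "viscosity_solution (cell_op p\<^sub>2 \<theta>\<^sub>2) (Hbar p\<^sub>2 \<theta>\<^sub>2) u"
      using effective_solution by blast
    have HM: "Hbar p\<^sub>2 \<theta>\<^sub>2 \<le> M"
      by (rule Hbar_le_bound, rule M) (use * in \<open>auto simp: dist_commute\<close>)
    have d12: "dist p\<^sub>1 p\<^sub>2 < 2 * (d/4)" "dist p\<^sub>1 p\<^sub>2 < 2" "dist \<theta>\<^sub>1 \<theta>\<^sub>2 < 2 * (d/4)"
      using * dist_triangle2[of p\<^sub>1 p\<^sub>2 p] dist_triangle2[of \<theta>\<^sub>1 \<theta>\<^sub>2 \<theta>] by linarith+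
    have "viscosity_subsolution (cell_op p\<^sub>1 \<theta>\<^sub>1) (Hbar p\<^sub>2 \<theta>\<^sub>2 + e) u"
    proof (rule subsolution_weaken)
      show "viscosity_subsolution (cell_op p\<^sub>2 \<theta>\<^sub>2) (Hbar p\<^sub>2 \<theta>\<^sub>2) u"
        using u by (simp add: viscosity_solution_def)
      fix x q assume le: "H x (p\<^sub>2 + q) \<theta>\<^sub>2 \<le> Hbar p\<^sub>2 \<theta>\<^sub>2"
      have "\<theta> - 1 \<le> \<theta>\<^sub>2" using *(4) unfolding dist_real_def by linarith
      then have "H x (p\<^sub>2 + q) (\<theta> - 1) \<le> M" using mono le HM by (meson order_trans)
      then have n2: "norm (p\<^sub>2 + q) < K" by (rule K(2))
      have "norm (p\<^sub>1 + q) \<le> norm (p\<^sub>2 + q) + norm (p\<^sub>1 - p\<^sub>2)"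
        using norm_triangle_ineq[of "p\<^sub>2 + q" "p\<^sub>1 - p\<^sub>2"] by (simp add: add.commute)
      then have n1: "norm (p\<^sub>1 + q) < K + 2" using n2 d12(2) by (simp add: dist_norm)
      obtain y where y: "y \<in> cell 1" "\<And>q s. H x q s = H y q s" using shift by blast
      have "dist (y, p\<^sub>1 + q, \<theta>\<^sub>1) (y, p\<^sub>2 + q, \<theta>\<^sub>2) = sqrt ((dist p\<^sub>1 p\<^sub>2)\<^sup>2 + (dist \<theta>\<^sub>1 \<theta>\<^sub>2)\<^sup>2)"
        by (simp add: dist_Pair_Pair)
      also have "\<dots> \<le> dist p\<^sub>1 p\<^sub>2 + dist \<theta>\<^sub>1 \<theta>\<^sub>2" by (rule sqrt_sum_squares_le_sum) auto
      also have "\<dots> < d" using d12 by linarith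
      finally have "dist (H y (p\<^sub>1 + q) \<theta>\<^sub>1) (H y (p\<^sub>2 + q) \<theta>\<^sub>2) < e"
        using d(2)[of "(y, p\<^sub>2 + q, \<theta>\<^sub>2)" "(y, p\<^sub>1 + q, \<theta>\<^sub>1)"] y(1) n1 n2 *(3,4)
        by (simp add: S_def dist_commute)
      then show "H x (p\<^sub>1 + q) \<theta>\<^sub>1 \<le> Hbar p\<^sub>2 \<theta>\<^sub>2 + e"
        using le unfolding y(2) dist_real_def by linarith
    qed
    then show "Hbar p\<^sub>1 \<theta>\<^sub>1 \<le> Hbar p\<^sub>2 \<theta>\<^sub>2 + e"
      using u by (intro Hbar_le) (auto simp: viscosity_solution_def)
  qed (use d in auto)
qed

lemma Hbar_continuous: "continuous_on UNIV (\<lambda>(p, \<theta>). Hbar p \<theta>)"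
  unfolding continuous_on_iff
proof (intro ballI allI impI)
  fix z :: "(real^'n) \<times> real" and e :: real assume "0 < e"
  obtain p \<theta> where z: "z = (p, \<theta>)" by (cases z)
  obtain d where d: "d > 0" "\<And>p\<^sub>1 p\<^sub>2 \<theta>\<^sub>1 \<theta>\<^sub>2. dist p\<^sub>1 p < d \<Longrightarrow> dist p\<^sub>2 p < d \<Longrightarrow> dist \<theta>\<^sub>1 \<theta> < d \<Longrightarrow>
      dist \<theta>\<^sub>2 \<theta> < d \<Longrightarrow> Hbar p\<^sub>1 \<theta>\<^sub>1 \<le> Hbar p\<^sub>2 \<theta>\<^sub>2 + e/2"
    using Hbar_locally_close[of "e/2" p \<theta>] \<open>0 < e\<close> by auto
  show "\<exists>d>0. \<forall>x'\<in>UNIV. dist x' z < d \<longrightarrow> dist ((\<lambda>(p, \<theta>). Hbar p \<theta>) x') ((\<lambda>(p, \<theta>). Hbar p \<theta>) z) < e"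
  proof (intro exI[of _ d] conjI ballI impI d(1))
    fix z' assume "dist z' z < d"
    moreover obtain p' \<theta>' where z': "z' = (p', \<theta>')" by (cases z')
    ultimately have "dist p' p < d" "dist \<theta>' \<theta> < d"
      using dist_fst_le[of z' z] dist_snd_le[of z' z] by (auto simp: z)
    then have "Hbar p' \<theta>' \<le> Hbar p \<theta> + e/2" "Hbar p \<theta> \<le> Hbar p' \<theta>' + e/2"
      using d by simp_all
    then show "dist ((\<lambda>(p, \<theta>). Hbar p \<theta>) z') ((\<lambda>(p, \<theta>). Hbar p \<theta>) z) < e"
      using \<open>0 < e\<close> unfolding z z' dist_real_def by simp
  qed
qed

lemma continuous_on_Hbar:
  assumes "continuous_on S f" "continuous_on S g"
  shows "continuous_on S (\<lambda>z. Hbar (f z) (g z))"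
proof -
  have "continuous_on S (\<lambda>z. (\<lambda>(p, \<theta>). Hbar p \<theta>) (f z, g z))"
    by (rule continuous_on_compose2[OF Hbar_continuous]) (auto intro!: continuous_intros assms)
  then show ?thesis by simp
qed

section \<open>The oscillating equation\<close>

abbreviation "eps_op \<epsilon> \<equiv> (\<lambda>x p \<theta>. H (x /\<^sub>R \<epsilon>) p \<theta>)"

lemma eps_op_cont: "continuous_on UNIV (\<lambda>(x, p, s). eps_op \<epsilon> x p s)"
  unfolding case_prod_beta by (intro continuous_on_H continuous_intros)

lemma eps_op_shift:
  assumes "\<epsilon> \<noteq> 0" "\<And>i. k $ i \<in> \<int>"
  shows "eps_op \<epsilon> (x + \<epsilon> *\<^sub>R k) p s = eps_op \<epsilon> x p s"
  using H_shift[OF assms(2), of "x /\<^sub>R \<epsilon>"] assms(1) by (simp add: scaleR_add_right)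

text \<open>
  The constant is uniform for \<open>\<theta>\<close> in a compact interval, because all these solutions are Lipschitz
  with the constant that coercivity gives at the left end \<open>a\<close>.
\<close>

lemma bounded_cell_solution:
  "\<exists>C>0. \<forall>\<theta>\<in>{a..b}. \<exists>w. lattice_periodic 1 w \<and> viscosity_solution (cell_op 0 \<theta>) (Hbar 0 \<theta>) w \<and>
     (\<forall>x. 0 \<le> w x \<and> w x \<le> C)"
proof -
  obtain M where M: "\<And>x. \<bar>H x 0 b\<bar> \<le> M" using H_bounded by metis
  obtain K where K: "K > 0" "\<And>x q. H x q a \<le> M \<Longrightarrow> norm q < K" using coercive by metis
  define C where "C = K * diameter (cell 1 :: (real^'n) set) + 1"
  have "0 \<le> K * diameter (cell 1 :: (real^'n) set)"
    using K diameter_ge_0[OF compact_imp_bounded[OF compact_cell]] by (intro mult_nonneg_nonneg) auto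
  then have C: "C > 0" by (simp add: C_def)
  have "\<exists>w. lattice_periodic 1 w \<and> viscosity_solution (cell_op 0 \<theta>) (Hbar 0 \<theta>) w \<and> (\<forall>x. 0 \<le> w x \<and> w x \<le> C)"
    if \<theta>: "\<theta> \<in> {a..b}" for \<theta>
  proof -
    obtain w where w: "lattice_periodic 1 w" "viscosity_solution (cell_op 0 \<theta>) (Hbar 0 \<theta>) w"
      using effective_solution by blast
    then have wc: "continuous_on UNIV w" and sub: "viscosity_subsolution (cell_op 0 \<theta>) (Hbar 0 \<theta>) w"
      and super: "viscosity_supersolution (cell_op 0 \<theta>) (Hbar 0 \<theta>) w"
      by (auto simp: viscosity_solution_def)
    obtain B where B: "\<And>x. \<bar>w x\<bar> \<le> B" using periodic_bounded[OF w(1) wc] by auto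
    have HM: "Hbar 0 \<theta> \<le> M"
    proof (rule Hbar_le_bound)
      show "H x 0 \<theta> \<le> M" for x using mono[of \<theta> b x 0] \<theta> M[of x] by (simp add: abs_le_iff)
    qed
    have co: "norm q < K" if "H x (0 + q) \<theta> \<le> Hbar 0 \<theta>" for x q
      using that mono[of a \<theta> x q] \<theta> HM by (intro K(2)[of x]) simp
    have lip: "w y - w x \<le> K * norm (y - x)" for x y
      by (rule subsolution_lipschitz[OF wc B sub K(1) co])
    have osc: "w y - w x \<le> C" for x y
      using periodic_lipschitz_oscillation[OF w(1) lip K(1), of y x]
      by (simp add: C_def)
    define m where "m = (INF x. w x)"
    have "bdd_below (range w)" by (rule bdd_belowI[of _ "- B"]) (use B in \<open>auto simp: abs_le_iff minus_le_iff\<close>)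
    then have m: "m \<le> w x" for x unfolding m_def by (intro cINF_lower) auto
    have m': "w x - C \<le> m" for x
      unfolding m_def by (intro cINF_greatest) (use osc[of x] in \<open>auto simp: algebra_simps\<close>)
    have "viscosity_solution (cell_op 0 \<theta>) (Hbar 0 \<theta>) (\<lambda>x. - m + w x)"
      unfolding viscosity_solution_def
      using subsolution_rescale[OF sub, of 1 0 "- m"] supersolution_rescale[OF super, of 1 0 "- m"] wc
      by (auto intro!: continuous_intros)
    moreover have "lattice_periodic 1 (\<lambda>x. - m + w x)" using w(1) by (auto simp: lattice_periodic_def)
    ultimately show ?thesis using m m' by (intro exI[of _ "\<lambda>x. - m + w x"]) (auto simp: algebra_simps)
  qed
  then show ?thesis using C by blast
qed

text \<open>
  With a corrector \<open>0 \<le> w \<le> C\<close> the two functions are \<open>\<theta> + \<epsilon> (w(x/\<epsilon>) - C)\<close> and \<open>\<theta> + \<epsilon> w(x/\<epsilon>)\<close>.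
  They solve the equation with the value frozen at \<open>\<theta>\<close>; as one stays below \<open>\<theta>\<close> and the other above,
  monotonicity turns the frozen equation into the required inequality.
\<close>

lemma barriers:
  "\<exists>C>0. \<forall>\<theta>\<in>{a..b}. \<forall>\<epsilon>>0. \<exists>lo hi.
     lattice_periodic \<epsilon> lo \<and> lattice_periodic \<epsilon> hi \<and> continuous_on UNIV lo \<and> continuous_on UNIV hi \<and>
     viscosity_subsolution (eps_op \<epsilon>) (Hbar 0 \<theta>) lo \<and> viscosity_supersolution (eps_op \<epsilon>) (Hbar 0 \<theta>) hi \<and>
     (\<forall>x. \<theta> - C * \<epsilon> \<le> lo x \<and> lo x \<le> \<theta> \<and> \<theta> \<le> hi x \<and> hi x \<le> \<theta> + C * \<epsilon>)"
proof -
  obtain C where C: "C > 0" "\<And>\<theta>. \<theta> \<in> {a..b} \<Longrightarrow> \<exists>w. lattice_periodic 1 w \<and> viscosity_solution (cell_op 0 \<theta>) (Hbar 0 \<theta>) w \<and>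
     (\<forall>x. 0 \<le> w x \<and> w x \<le> C)" using bounded_cell_solution by metis
  have "\<exists>lo hi. lattice_periodic \<epsilon> lo \<and> lattice_periodic \<epsilon> hi \<and> continuous_on UNIV lo \<and> continuous_on UNIV hi \<and>
     viscosity_subsolution (eps_op \<epsilon>) (Hbar 0 \<theta>) lo \<and> viscosity_supersolution (eps_op \<epsilon>) (Hbar 0 \<theta>) hi \<and>
     (\<forall>x. \<theta> - C * \<epsilon> \<le> lo x \<and> lo x \<le> \<theta> \<and> \<theta> \<le> hi x \<and> hi x \<le> \<theta> + C * \<epsilon>)"
    if \<theta>: "\<theta> \<in> {a..b}" and \<epsilon>: "0 < \<epsilon>" for \<theta> \<epsilon>
  proof -
    obtain w where w: "lattice_periodic 1 w" "viscosity_solution (cell_op 0 \<theta>) (Hbar 0 \<theta>) w"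
      "\<And>x. 0 \<le> w x" "\<And>x. w x \<le> C" using C(2)[OF \<theta>] by blast
    have wc: "continuous_on UNIV w" and sub: "viscosity_subsolution (cell_op 0 \<theta>) (Hbar 0 \<theta>) w"
      and super: "viscosity_supersolution (cell_op 0 \<theta>) (Hbar 0 \<theta>) w"
      using w by (auto simp: viscosity_solution_def)
    define h where "h k x = k + w (inverse \<epsilon> *\<^sub>R x + 0) / inverse \<epsilon>" for k x
    have h: "h k x = k + \<epsilon> * w (x /\<^sub>R \<epsilon>)" for k x by (simp add: h_def divide_inverse)
    have hp: "lattice_periodic \<epsilon> (h k)" for k
      unfolding lattice_periodic_def
    proof (intro allI impI)
      fix x j :: "real^'n" assume j: "\<forall>i. j $ i \<in> \<int>"
      have "(x + \<epsilon> *\<^sub>R j) /\<^sub>R \<epsilon> = x /\<^sub>R \<epsilon> + 1 *\<^sub>R j" using \<epsilon> by (simp add: scaleR_add_right)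
      then show "h k (x + \<epsilon> *\<^sub>R j) = h k x" using periodicD[OF w(1)] j by (simp only: h)
    qed
    have hc: "continuous_on UNIV (h k)" for k
      unfolding h by (intro continuous_intros continuous_on_compose2[OF wc]) auto
    have hb: "k \<le> h k x" "h k x \<le> k + C * \<epsilon>" for k x
      using w(3,4)[of "x /\<^sub>R \<epsilon>"] \<epsilon> by (simp_all add: h mult.commute)
    have "viscosity_subsolution (eps_op \<epsilon>) (Hbar 0 \<theta>) (h (\<theta> - C * \<epsilon>))"
    proof (rule subsolution_weaken)
      show "viscosity_subsolution (\<lambda>x p s. H (inverse \<epsilon> *\<^sub>R x + 0) (0 + p) \<theta>) (Hbar 0 \<theta>) (h (\<theta> - C * \<epsilon>))"
        unfolding h_def by (rule subsolution_rescale[OF sub]) (use \<epsilon> in simp)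
      fix x p assume "H (inverse \<epsilon> *\<^sub>R x + 0) (0 + p) \<theta> \<le> Hbar 0 \<theta>"
      moreover have "h (\<theta> - C * \<epsilon>) x \<le> \<theta>" using hb(2)[of "\<theta> - C * \<epsilon>" x] by simp
      ultimately show "H (x /\<^sub>R \<epsilon>) p (h (\<theta> - C * \<epsilon>) x) \<le> Hbar 0 \<theta>"
        using mono[of "h (\<theta> - C * \<epsilon>) x" \<theta> "x /\<^sub>R \<epsilon>" p] by simp
    qed
    moreover have "viscosity_supersolution (eps_op \<epsilon>) (Hbar 0 \<theta>) (h \<theta>)"
    proof (rule supersolution_weaken)
      show "viscosity_supersolution (\<lambda>x p s. H (inverse \<epsilon> *\<^sub>R x + 0) (0 + p) \<theta>) (Hbar 0 \<theta>) (h \<theta>)"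
        unfolding h_def by (rule supersolution_rescale[OF super]) (use \<epsilon> in simp)
      fix x p assume "Hbar 0 \<theta> \<le> H (inverse \<epsilon> *\<^sub>R x + 0) (0 + p) \<theta>"
      then show "Hbar 0 \<theta> \<le> H (x /\<^sub>R \<epsilon>) p (h \<theta> x)"
        using mono[OF hb(1)[of \<theta> x], of "x /\<^sub>R \<epsilon>" p] by simp
    qed
    ultimately show ?thesis
      using hb(1)[of "\<theta> - C * \<epsilon>"] hb(2)[of "\<theta> - C * \<epsilon>"] hb(1)[of \<theta>] hb(2)[of \<theta>]
      by (intro exI[of _ "h (\<theta> - C * \<epsilon>)"] exI[of _ "h \<theta>"]) (simp add: hp hc)
  qed
  then show ?thesis using C(1) by blast
qed

lemma eps_solutionsD:
  assumes "\<omega> \<in> eps_solutions H c \<epsilon>"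
  shows "lattice_periodic \<epsilon> \<omega>" "continuous_on UNIV \<omega>"
    "viscosity_subsolution (eps_op \<epsilon>) c \<omega>" "viscosity_supersolution (eps_op \<epsilon>) c \<omega>"
  using assms by (auto simp: eps_solutions_def viscosity_solution_def)

text \<open>
  By monotonicity in the value, a lower bound for \<open>u\<close> gives the coercivity that the general
  comparison principle asks for.
\<close>

lemma eps_comparison:
  assumes \<epsilon>: "0 < \<epsilon>"
    and u: "lattice_periodic \<epsilon> u" "continuous_on UNIV u" "viscosity_subsolution (eps_op \<epsilon>) c\<^sub>1 u"
    and v: "lattice_periodic \<epsilon> v" "continuous_on UNIV v" "viscosity_supersolution (eps_op \<epsilon>) c\<^sub>2 v"
    and lt: "c\<^sub>1 < c\<^sub>2"
  shows "u x \<le> v x"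
proof -
  obtain B where B: "\<And>x. \<bar>u x\<bar> \<le> B" using periodic_bounded[OF u(1,2) \<epsilon>] by auto
  obtain K where K: "K > 0" "\<And>x q. H x q (- B) \<le> c\<^sub>1 \<Longrightarrow> norm q < K" using coercive by metis
  show ?thesis
  proof (rule comparison[OF eps_op_cont _ \<epsilon> u(2,1,3) v(2,1,3) K(1) _ lt])
    fix x p assume "H (x /\<^sub>R \<epsilon>) p (u x) \<le> c\<^sub>1"
    moreover have "- B \<le> u x" using B[of x] by linarith
    ultimately have "H (x /\<^sub>R \<epsilon>) p (- B) \<le> c\<^sub>1" using mono order_trans by blast
    then show "norm p < K" by (rule K)
  qed (rule mono)
qed

lemma eps_perron:
  assumes \<epsilon>: "0 < \<epsilon>"
    and v: "lattice_periodic \<epsilon> v" "continuous_on UNIV v" "viscosity_subsolution (eps_op \<epsilon>) c v"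
    and \<psi>: "lattice_periodic \<epsilon> \<psi>" "continuous_on UNIV \<psi>" "viscosity_supersolution (eps_op \<epsilon>) c \<psi>"
    and le: "\<And>x. v x \<le> \<psi> x"
  obtains u where "u \<in> eps_solutions H c \<epsilon>" "\<And>x. v x \<le> u x" "\<And>x. u x \<le> \<psi> x"
    "\<And>w x. continuous_on UNIV w \<Longrightarrow> viscosity_subsolution (eps_op \<epsilon>) c w \<Longrightarrow> (\<And>x. v x \<le> w x) \<Longrightarrow>
       (\<And>x. w x \<le> \<psi> x) \<Longrightarrow> w x \<le> u x"
proof -
  obtain B where B: "\<And>x. \<bar>v x\<bar> \<le> B" using periodic_bounded[OF v(1,2) \<epsilon>] by auto
  obtain B' where B': "\<And>x. \<bar>\<psi> x\<bar> \<le> B'" using periodic_bounded[OF \<psi>(1,2) \<epsilon>] by auto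
  obtain K where K: "K > 0" "\<And>x q. H x q (- B) \<le> c \<Longrightarrow> norm q < K" using coercive by metis
  have lo: "- B \<le> v x" and hi: "\<psi> x \<le> B'" for x using B[of x] B'[of x] by linarith+
  have co: "norm p < K" if "- B \<le> s" "eps_op \<epsilon> x p s \<le> c" for x p s
    by (rule K(2)) (use mono[OF that(1)] that(2) order_trans in blast)
  show thesis
  proof (rule perron[OF eps_op_cont v(2,3) \<psi>(2,3) le lo hi co K(1)])
    fix u
    assume u: "viscosity_solution (eps_op \<epsilon>) c u" "\<And>x. v x \<le> u x" "\<And>x. u x \<le> \<psi> x"
      and max: "\<And>w x. continuous_on UNIV w \<Longrightarrow> viscosity_subsolution (eps_op \<epsilon>) c w \<Longrightarrow> (\<And>x. v x \<le> w x) \<Longrightarrow>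
       (\<And>x. w x \<le> \<psi> x) \<Longrightarrow> w x \<le> u x"
      and shift: "\<And>\<tau> x. (\<And>x p s. eps_op \<epsilon> (x + \<tau>) p s = eps_op \<epsilon> x p s) \<Longrightarrow> (\<And>x. v (x + \<tau>) = v x) \<Longrightarrow>
       (\<And>x. \<psi> (x + \<tau>) = \<psi> x) \<Longrightarrow> u (x + \<tau>) = u x"
    have "lattice_periodic \<epsilon> u"
      unfolding lattice_periodic_def
    proof (intro allI impI)
      fix x j :: "real^'n" assume j: "\<forall>i. j $ i \<in> \<int>"
      show "u (x + \<epsilon> *\<^sub>R j) = u x"
        using j \<epsilon> by (intro shift eps_op_shift periodicD[OF v(1)] periodicD[OF \<psi>(1)]) auto
    qed
    then have "u \<in> eps_solutions H c \<epsilon>" using u(1) by (simp add: eps_solutions_def)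
    then show thesis by (rule that) (use u max in blast)+
  qed
qed

theorem eps_solution_exists:
  "\<exists>C>0. \<forall>\<epsilon>>0. \<exists>\<omega>\<in>eps_solutions H (Hbar 0 \<theta>) \<epsilon>. \<forall>x. \<theta> - C * \<epsilon> \<le> \<omega> x \<and> \<omega> x \<le> \<theta> + C * \<epsilon>"
proof -
  obtain C where C: "C > 0" "\<And>\<epsilon>. \<epsilon> > 0 \<Longrightarrow> \<exists>lo hi.
     lattice_periodic \<epsilon> lo \<and> lattice_periodic \<epsilon> hi \<and> continuous_on UNIV lo \<and> continuous_on UNIV hi \<and>
     viscosity_subsolution (eps_op \<epsilon>) (Hbar 0 \<theta>) lo \<and> viscosity_supersolution (eps_op \<epsilon>) (Hbar 0 \<theta>) hi \<and>
     (\<forall>x. \<theta> - C * \<epsilon> \<le> lo x \<and> lo x \<le> \<theta> \<and> \<theta> \<le> hi x \<and> hi x \<le> \<theta> + C * \<epsilon>)"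
    using barriers[of \<theta> \<theta>] by (metis atLeastAtMost_iff order_refl)
  have "\<exists>\<omega>\<in>eps_solutions H (Hbar 0 \<theta>) \<epsilon>. \<forall>x. \<theta> - C * \<epsilon> \<le> \<omega> x \<and> \<omega> x \<le> \<theta> + C * \<epsilon>" if \<epsilon>: "\<epsilon> > 0" for \<epsilon>
  proof -
    obtain lo hi where b: "lattice_periodic \<epsilon> lo" "lattice_periodic \<epsilon> hi" "continuous_on UNIV lo" "continuous_on UNIV hi"
     "viscosity_subsolution (eps_op \<epsilon>) (Hbar 0 \<theta>) lo" "viscosity_supersolution (eps_op \<epsilon>) (Hbar 0 \<theta>) hi"
     "\<And>x. \<theta> - C * \<epsilon> \<le> lo x" "\<And>x. lo x \<le> \<theta>" "\<And>x. \<theta> \<le> hi x" "\<And>x. hi x \<le> \<theta> + C * \<epsilon>"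
      using C(2)[OF \<epsilon>] by blast
    obtain u where u: "u \<in> eps_solutions H (Hbar 0 \<theta>) \<epsilon>" "\<And>x. lo x \<le> u x" "\<And>x. u x \<le> hi x"
      by (rule eps_perron[OF \<epsilon> b(1,3,5) b(2,4,6) order_trans[OF b(8,9)]]) blast
    show ?thesis using u b(7,10) order_trans by (intro bexI[OF _ u(1)]) blast
  qed
  then show ?thesis using C(1) by blast
qed

text \<open>
  The strict subsolution supplied by \<open>\<theta>\<close> lies below every solution, hence below their infimum.  This
  infimum is a supersolution, so Perron's method gives a solution under it, and the two have to
  coincide.
\<close>

lemma least_eps_solution:
  assumes \<epsilon>: "0 < \<epsilon>" and ne: "eps_solutions H c \<epsilon> \<noteq> {}" and lt: "Hbar 0 \<theta> < c"
  shows "u_minus H c \<epsilon> \<in> eps_solutions H c \<epsilon>"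
    and "\<omega> \<in> eps_solutions H c \<epsilon> \<Longrightarrow> u_minus H c \<epsilon> x \<le> \<omega> x"
proof -
  let ?S = "eps_solutions H c \<epsilon>"
  let ?u = "u_minus H c \<epsilon>"
  obtain lo where lo: "lattice_periodic \<epsilon> lo" "continuous_on UNIV lo" "viscosity_subsolution (eps_op \<epsilon>) (Hbar 0 \<theta>) lo"
    using barriers[of \<theta> \<theta>] \<epsilon> by (metis atLeastAtMost_iff order_refl)
  obtain B where B: "\<And>x. \<bar>lo x\<bar> \<le> B" using periodic_bounded[OF lo(1,2) \<epsilon>] by auto
  have ge: "lo x \<le> \<omega> x" if "\<omega> \<in> ?S" for \<omega> x
    using eps_solutionsD[OF that] by (intro eps_comparison[OF \<epsilon> lo _ _ _ lt])
  have lower: "?u x \<le> \<omega> x" if "\<omega> \<in> ?S" for \<omega> x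
    unfolding u_minus_def by (intro cINF_lower that bdd_belowI[of _ "lo x"]) (auto intro: ge)
  then show "\<omega> \<in> ?S \<Longrightarrow> ?u x \<le> \<omega> x" by blast
  have greatest: "k \<le> ?u x" if "\<And>\<omega>. \<omega> \<in> ?S \<Longrightarrow> k \<le> \<omega> x" for k x
    unfolding u_minus_def by (intro cINF_greatest ne that)
  obtain K where K: "K > 0" "\<And>x q. H x q (- B) \<le> c \<Longrightarrow> norm q < K" using coercive by metis
  have lip: "\<omega> y - \<omega> x \<le> K * norm (y - x)" if \<omega>: "\<omega> \<in> ?S" for \<omega> x y
  proof -
    note D = eps_solutionsD[OF \<omega>]
    obtain B' where B': "\<And>x. \<bar>\<omega> x\<bar> \<le> B'" using periodic_bounded[OF D(1,2) \<epsilon>] by auto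
    show ?thesis
    proof (rule subsolution_lipschitz[OF D(2) B' D(3) K(1)])
      fix x p assume "H (x /\<^sub>R \<epsilon>) p (\<omega> x) \<le> c"
      moreover have "- B \<le> \<omega> x" using ge[OF \<omega>, of x] B[of x] by linarith
      ultimately have "H (x /\<^sub>R \<epsilon>) p (- B) \<le> c" using mono order_trans by blast
      then show "norm p < K" by (rule K)
    qed
  qed
  have lipu: "?u y - ?u x \<le> K * norm (y - x)" for x y
  proof -
    have "?u y - K * norm (y - x) \<le> ?u x"
    proof (rule greatest)
      fix \<omega> assume "\<omega> \<in> ?S"
      from lip[OF this, of y x] lower[OF this, of y] show "?u y - K * norm (y - x) \<le> \<omega> x" by linarith
    qed
    then show ?thesis by linarith
  qed
  have uc: "continuous_on UNIV ?u" using lipu K(1) by (rule lipschitz_continuous)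
  have super: "viscosity_supersolution (eps_op \<epsilon>) c ?u"
  proof (rule supersolution_stability[OF eps_op_cont uc])
    fix x :: "real^'n" and e r :: real assume e: "0 < e"
    have "\<exists>\<omega>\<in>?S. \<omega> x < ?u x + e"
    proof (rule ccontr)
      assume "\<not> ?thesis"
      then have "?u x + e \<le> ?u x" by (intro greatest) force
      then show False using e by simp
    qed
    then obtain \<omega> where \<omega>: "\<omega> \<in> ?S" "\<omega> x < ?u x + e" by blast
    note D = eps_solutionsD[OF \<omega>(1)]
    show "\<exists>w. continuous_on UNIV w \<and> viscosity_supersolution (eps_op \<epsilon>) (c - e) w \<and>
           (\<forall>y\<in>cball x r. ?u y - e \<le> w y) \<and> w x \<le> ?u x + e"
    proof (intro exI[of _ \<omega>] conjI ballI)
      show "viscosity_supersolution (eps_op \<epsilon>) (c - e) \<omega>"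
        using D(4) by (rule supersolution_weaken) (use e in auto)
      show "?u y - e \<le> \<omega> y" for y using lower[OF \<omega>(1), of y] e by linarith
    qed (use \<omega> D in auto)
  qed
  have per: "lattice_periodic \<epsilon> ?u"
    unfolding lattice_periodic_def
  proof (intro allI impI)
    fix x j :: "real^'n" assume j: "\<forall>i. j $ i \<in> \<int>"
    have "\<omega> (x + \<epsilon> *\<^sub>R j) = \<omega> x" if "\<omega> \<in> ?S" for \<omega>
      using j by (intro periodicD[OF eps_solutionsD(1)[OF that]]) auto
    then show "?u (x + \<epsilon> *\<^sub>R j) = ?u x" unfolding u_minus_def by (intro INF_cong) auto
  qed
  have lo_sub: "viscosity_subsolution (eps_op \<epsilon>) c lo"
    using lo(3) by (rule subsolution_weaken) (use lt in auto)
  have lo_le: "lo x \<le> ?u x" for x by (rule greatest) (rule ge)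
  obtain u where u: "u \<in> ?S" "\<And>x. u x \<le> ?u x"
    by (rule eps_perron[OF \<epsilon> lo(1,2) lo_sub per uc super lo_le]) blast
  have "u = ?u" using u(2) lower[OF u(1)] by (intro ext antisym)
  then show "?u \<in> ?S" using u(1) by simp
qed

text \<open>
  Perron's method between one solution \<open>\<omega>0\<close> and the strict supersolution supplied by \<open>\<theta>\<close> produces a
  solution that dominates \<open>max \<omega> \<omega>0\<close> for every solution \<open>\<omega>\<close>.
\<close>

lemma greatest_eps_solution:
  assumes \<epsilon>: "0 < \<epsilon>" and ne: "eps_solutions H c \<epsilon> \<noteq> {}" and lt: "c < Hbar 0 \<theta>"
  shows "u_plus H c \<epsilon> \<in> eps_solutions H c \<epsilon>"
    and "\<omega> \<in> eps_solutions H c \<epsilon> \<Longrightarrow> \<omega> x \<le> u_plus H c \<epsilon> x"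
proof -
  let ?S = "eps_solutions H c \<epsilon>"
  obtain hi where hi: "lattice_periodic \<epsilon> hi" "continuous_on UNIV hi" "viscosity_supersolution (eps_op \<epsilon>) (Hbar 0 \<theta>) hi"
    using barriers[of \<theta> \<theta>] \<epsilon> by (metis atLeastAtMost_iff order_refl)
  have le: "\<omega> x \<le> hi x" if "\<omega> \<in> ?S" for \<omega> x
    using eps_solutionsD[OF that] by (intro eps_comparison[OF \<epsilon> _ _ _ hi lt])
  obtain \<omega>0 where \<omega>0: "\<omega>0 \<in> ?S" using ne by blast
  note D0 = eps_solutionsD[OF \<omega>0]
  have hi_super: "viscosity_supersolution (eps_op \<epsilon>) c hi"
    using hi(3) by (rule supersolution_weaken) (use lt in auto)
  obtain u where u: "u \<in> ?S"
    "\<And>w x. continuous_on UNIV w \<Longrightarrow> viscosity_subsolution (eps_op \<epsilon>) c w \<Longrightarrow> (\<And>x. \<omega>0 x \<le> w x) \<Longrightarrow>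
       (\<And>x. w x \<le> hi x) \<Longrightarrow> w x \<le> u x"
    by (rule eps_perron[OF \<epsilon> D0(1,2,3) hi(1,2) hi_super le[OF \<omega>0]]) blast
  have max: "\<omega> x \<le> u x" if "\<omega> \<in> ?S" for \<omega> x
  proof -
    note D = eps_solutionsD[OF that]
    have "max (\<omega> x) (\<omega>0 x) \<le> u x"
    proof (rule u(2))
      show "continuous_on UNIV (\<lambda>x. max (\<omega> x) (\<omega>0 x))" by (intro continuous_on_max D D0)
      show "viscosity_subsolution (eps_op \<epsilon>) c (\<lambda>x. max (\<omega> x) (\<omega>0 x))"
        by (rule max_subsolution[OF D(3) D0(3)])
    qed (use le[OF that] le[OF \<omega>0] in auto)
    then show ?thesis by simp
  qed
  have "u_plus H c \<epsilon> = u"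
    unfolding u_plus_def
  proof (rule ext, rule antisym)
    fix x
    show "(SUP \<omega>\<in>?S. \<omega> x) \<le> u x" by (intro cSUP_least ne max)
    show "u x \<le> (SUP \<omega>\<in>?S. \<omega> x)"
      by (intro cSUP_upper u(1) bdd_aboveI[of _ "u x"]) (auto intro: max)
  qed
  then show "u_plus H c \<epsilon> \<in> ?S" "\<omega> \<in> ?S \<Longrightarrow> \<omega> x \<le> u_plus H c \<epsilon> x" using u(1) max by simp_all
qed

end

section \<open>Rate of convergence and the homogenized equation\<close>

lemma Linf_norm_le:
  assumes "continuous_on UNIV u" "\<And>x. \<bar>u x - k\<bar> \<le> C"
  shows "Linf_norm (\<lambda>x. u x - k) \<le> ereal C"
  unfolding Linf_norm_def
proof (rule esssup_I)
  have "u \<in> borel_measurable borel" by (rule borel_measurable_continuous_onI[OF assms(1)])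
  then have "(\<lambda>x. ereal \<bar>u x - k\<bar>) \<in> borel_measurable lborel" by simp
  then show "(\<lambda>x. ereal \<bar>u x - k\<bar>) \<in> borel_measurable lebesgue" by (rule measurable_completion)
qed (use assms(2) in simp)

text \<open>
  Subtracting \<open>\<delta> * norm (y - z)^2\<close> makes the maximum of \<open>u\<close> attained, at a point where the value is at
  least \<open>u z\<close> and the gradient of the test function has norm at most a multiple of \<open>sqrt (\<delta> * B)\<close>.
  The value of \<open>\<delta>\<close> makes it smaller than \<open>d\<close>.
\<close>

lemma subsolution_range_bound:
  fixes F :: "'a::euclidean_space \<Rightarrow> real \<Rightarrow> real"
  assumes u: "continuous_on UNIV u" "\<And>x. \<bar>u x\<bar> \<le> B" "viscosity_subsolution (\<lambda>x. F) c u"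
    and mono: "\<And>p s t. s \<le> t \<Longrightarrow> F p s \<le> F p t"
    and cont: "continuous_on UNIV (\<lambda>p. F p s)"
    and lt: "s < u z"
  shows "F 0 s \<le> c"
proof (rule ccontr)
  assume "\<not> F 0 s \<le> c"
  then have pos: "0 < F 0 s - c" by simp
  then obtain d where d: "d > 0" "\<And>p. dist p 0 < d \<Longrightarrow> dist (F p s) (F 0 s) < F 0 s - c"
    using cont unfolding continuous_on_iff by (meson UNIV_I)
  have B: "0 \<le> B" using u(2)[of z] by linarith
  define \<delta> where "\<delta> = d\<^sup>2 / (8 * (B + 1))"
  have \<delta>: "\<delta> > 0" using d B by (simp add: \<delta>_def)
  have "8 * \<delta> * B = d\<^sup>2 * (B / (B + 1))" using B by (simp add: \<delta>_def field_simps)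
  also have "\<dots> < d\<^sup>2 * 1" using d B by (intro mult_strict_left_mono) auto
  finally have \<delta>d: "8 * \<delta> * B < d\<^sup>2" by simp
  define f where "f y = u y - \<delta> * (norm (y - z))\<^sup>2" for y
  have fc: "continuous_on UNIV f" unfolding f_def by (intro continuous_intros u)
  have "f y \<le> f z" if "sqrt (2 * B / \<delta>) < norm (y - z)" for y
  proof -
    have "(sqrt (2 * B / \<delta>))\<^sup>2 < (norm (y - z))\<^sup>2"
      using that B \<delta> by (intro power_strict_mono) auto
    then have "2 * B < \<delta> * (norm (y - z))\<^sup>2" using B \<delta> by (simp add: field_simps)
    then show ?thesis using u(2)[of y] u(2)[of z] by (simp add: f_def abs_le_iff)
  qed
  then obtain x where x: "\<And>y. f y \<le> f x" using attains_global_max[OF fc] by metis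
  have "u z \<le> u x - \<delta> * (norm (x - z))\<^sup>2" using x[of z] by (simp add: f_def)
  moreover have "0 \<le> \<delta> * (norm (x - z))\<^sup>2" using \<delta> by simp
  ultimately have le: "\<delta> * (norm (x - z))\<^sup>2 \<le> 2 * B" and ux: "s < u x"
    using u(2)[of x] u(2)[of z] lt by (simp_all add: abs_le_iff)
  have "\<forall>\<^sub>F y in nhds x. u y - (0 + \<delta> * (norm (y - z))\<^sup>2) \<le> u x - (0 + \<delta> * (norm (x - z))\<^sup>2)"
    by (rule always_eventually) (use x in \<open>simp add: f_def\<close>)
  from subsolutionD[OF u(3) C1_paraboloid this]
  have "F ((2 * \<delta>) *\<^sub>R (x - z)) (u x) \<le> c" .
  then have Fle: "F ((2 * \<delta>) *\<^sub>R (x - z)) s \<le> c"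
    using mono[of s "u x"] ux by (meson less_imp_le order_trans)
  have "(2 * \<delta> * norm (x - z))\<^sup>2 = 4 * \<delta> * (\<delta> * (norm (x - z))\<^sup>2)" by (simp add: power2_eq_square)
  also have "\<dots> \<le> 4 * \<delta> * (2 * B)" using le \<delta> by (intro mult_left_mono) auto
  also have "\<dots> < d\<^sup>2" using \<delta>d by simp
  finally have "2 * \<delta> * norm (x - z) < d" using d by (simp add: power_less_imp_less_base)
  then have "dist (F ((2 * \<delta>) *\<^sub>R (x - z)) s) (F 0 s) < F 0 s - c" using \<delta> by (intro d) simp
  then show False using Fle unfolding dist_real_def by linarith
qed

lemma supersolution_range_bound:
  fixes F :: "'a::euclidean_space \<Rightarrow> real \<Rightarrow> real"
  assumes u: "continuous_on UNIV u" "\<And>x. \<bar>u x\<bar> \<le> B" "viscosity_supersolution (\<lambda>x. F) c u"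
    and mono: "\<And>p s t. s \<le> t \<Longrightarrow> F p s \<le> F p t"
    and cont: "continuous_on UNIV (\<lambda>p. F p s)"
    and lt: "u z < s"
  shows "c \<le> F 0 s"
proof -
  have "- F (- 0) (- (- s)) \<le> - c"
  proof (rule subsolution_range_bound[where F = "\<lambda>p s. - F (- p) (- s)" and u = "\<lambda>x. - u x" and B = B and z = z])
    show "viscosity_subsolution (\<lambda>x p s. - F (- p) (- s)) (- c) (\<lambda>x. - u x)"
      using u(3) unfolding supersolution_iff_reflected_subsolution .
    have "continuous_on UNIV (\<lambda>p. F (- p) s)"
      by (rule continuous_on_compose2[OF cont]) (auto intro!: continuous_intros)
    then show "continuous_on UNIV (\<lambda>p. - F (- p) (- (- s)))" by (simp add: continuous_on_minus)
  qed (use u lt mono in \<open>auto simp: continuous_on_minus\<close>)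
  then show ?thesis by simp
qed

context monotone_coercive_hamiltonian
begin

text \<open>
  Strict comparison with the lower barrier works for each \<open>\<theta>'\<close> below \<open>\<theta>\<close>; the constant is uniform
  for \<open>\<theta>'\<close> in \<open>[\<theta> - 1, \<theta>]\<close>, so one can let \<open>\<theta>'\<close> tend to \<open>\<theta>\<close>.
\<close>

lemma eps_solutions_lower_bound:
  assumes below: "\<And>\<theta>'. \<theta>' < \<theta> \<Longrightarrow> Hbar 0 \<theta>' < c"
  shows "\<exists>C>0. \<forall>\<epsilon>>0. \<forall>\<omega>\<in>eps_solutions H c \<epsilon>. \<forall>x. \<theta> - C * \<epsilon> \<le> \<omega> x"
proof -
  obtain C where C: "C > 0" "\<And>\<theta>' \<epsilon>. \<theta>' \<in> {\<theta> - 1..\<theta>} \<Longrightarrow> \<epsilon> > 0 \<Longrightarrow> \<exists>lo. lattice_periodic \<epsilon> lo \<and>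
      continuous_on UNIV lo \<and> viscosity_subsolution (eps_op \<epsilon>) (Hbar 0 \<theta>') lo \<and> (\<forall>x. \<theta>' - C * \<epsilon> \<le> lo x)"
    using barriers[of "\<theta> - 1" \<theta>] by meson
  have "\<theta> - C * \<epsilon> \<le> \<omega> x" if \<epsilon>: "\<epsilon> > 0" and \<omega>: "\<omega> \<in> eps_solutions H c \<epsilon>" for \<epsilon> \<omega> x
  proof (rule field_le_epsilon)
    fix e :: real assume "e > 0"
    define \<theta>' where "\<theta>' = \<theta> - min e 1"
    have \<theta>': "\<theta>' \<in> {\<theta> - 1..\<theta>}" "\<theta>' < \<theta>" using \<open>e > 0\<close> by (auto simp: \<theta>'_def min_def)
    obtain lo where lo: "lattice_periodic \<epsilon> lo" "continuous_on UNIV lo"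
      "viscosity_subsolution (eps_op \<epsilon>) (Hbar 0 \<theta>') lo" "\<And>x. \<theta>' - C * \<epsilon> \<le> lo x"
      using C(2)[OF \<theta>'(1) \<epsilon>] by blast
    note D = eps_solutionsD[OF \<omega>]
    have "lo x \<le> \<omega> x" by (rule eps_comparison[OF \<epsilon> lo(1-3) D(1,2,4) below[OF \<theta>'(2)]])
    then show "\<theta> - C * \<epsilon> \<le> \<omega> x + e" using lo(4)[of x] by (simp add: \<theta>'_def min_def split: if_splits)
  qed
  then show ?thesis using C(1) by blast
qed

lemma eps_solutions_upper_bound:
  assumes above: "\<And>\<theta>'. \<theta> < \<theta>' \<Longrightarrow> c < Hbar 0 \<theta>'"
  shows "\<exists>C>0. \<forall>\<epsilon>>0. \<forall>\<omega>\<in>eps_solutions H c \<epsilon>. \<forall>x. \<omega> x \<le> \<theta> + C * \<epsilon>"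
proof -
  obtain C where C: "C > 0" "\<And>\<theta>' \<epsilon>. \<theta>' \<in> {\<theta>..\<theta> + 1} \<Longrightarrow> \<epsilon> > 0 \<Longrightarrow> \<exists>hi. lattice_periodic \<epsilon> hi \<and>
      continuous_on UNIV hi \<and> viscosity_supersolution (eps_op \<epsilon>) (Hbar 0 \<theta>') hi \<and> (\<forall>x. hi x \<le> \<theta>' + C * \<epsilon>)"
    using barriers[of \<theta> "\<theta> + 1"] by meson
  have "\<omega> x \<le> \<theta> + C * \<epsilon>" if \<epsilon>: "\<epsilon> > 0" and \<omega>: "\<omega> \<in> eps_solutions H c \<epsilon>" for \<epsilon> \<omega> x
  proof (rule field_le_epsilon)
    fix e :: real assume "e > 0"
    define \<theta>' where "\<theta>' = \<theta> + min e 1"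
    have \<theta>': "\<theta>' \<in> {\<theta>..\<theta> + 1}" "\<theta> < \<theta>'" using \<open>e > 0\<close> by (auto simp: \<theta>'_def min_def)
    obtain hi where hi: "lattice_periodic \<epsilon> hi" "continuous_on UNIV hi"
      "viscosity_supersolution (eps_op \<epsilon>) (Hbar 0 \<theta>') hi" "\<And>x. hi x \<le> \<theta>' + C * \<epsilon>"
      using C(2)[OF \<theta>'(1) \<epsilon>] by blast
    note D = eps_solutionsD[OF \<omega>]
    have "\<omega> x \<le> hi x" by (rule eps_comparison[OF \<epsilon> D(1,2,3) hi(1-3) above[OF \<theta>'(2)]])
    then show "\<omega> x \<le> \<theta> + C * \<epsilon> + e" using hi(4)[of x] by (simp add: \<theta>'_def min_def split: if_splits)
  qed
  then show ?thesis using C(1) by blast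
qed

lemma critical_values_eq: "critical_values H = range (Hbar 0)"
  by (auto simp: critical_values_def)

lemma connected_critical_values: "connected (critical_values H)"
  unfolding critical_values_eq
  by (intro connected_continuous_image continuous_on_Hbar continuous_intros connected_UNIV)

lemma eps_solutions_nonempty:
  assumes "c \<in> critical_values H" "0 < \<epsilon>"
  shows "eps_solutions H c \<epsilon> \<noteq> {}"
  using assms eps_solution_exists unfolding critical_values_eq by blast

lemma constant_homogenized_solution:
  "(\<lambda>x. \<theta>) \<in> homogenized_solutions H (Hbar 0 \<theta>)"
  unfolding homogenized_solutions_def viscosity_solution_def
  by (auto intro!: constant_subsolution constant_supersolution)

lemma closed_level_set: "closed (level_set H c)"
  unfolding level_set_def by (intro closed_Collect_eq continuous_on_Hbar continuous_intros)

lemma level_set_nonempty: "c \<in> critical_values H \<Longrightarrow> level_set H c \<noteq> {}"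
  by (auto simp: critical_values_def level_set_def)

lemma below_level_set:
  assumes "c \<in> critical_values H" "bdd_below (level_set H c)"
  shows "Hbar 0 (Inf (level_set H c)) = c" "\<theta> < Inf (level_set H c) \<Longrightarrow> Hbar 0 \<theta> < c"
proof -
  have "Inf (level_set H c) \<in> level_set H c"
    by (rule closed_contains_Inf) (use assms closed_level_set level_set_nonempty in auto)
  then show eq: "Hbar 0 (Inf (level_set H c)) = c" by (simp add: level_set_def)
  assume lt: "\<theta> < Inf (level_set H c)"
  then have "Hbar 0 \<theta> \<noteq> c" using cInf_lower[OF _ assms(2), of \<theta>] by (auto simp: level_set_def)
  moreover have "Hbar 0 \<theta> \<le> c" using Hbar_mono[of \<theta> "Inf (level_set H c)" 0] lt eq by simp
  ultimately show "Hbar 0 \<theta> < c" by simp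
qed

lemma above_level_set:
  assumes "c \<in> critical_values H" "bdd_above (level_set H c)"
  shows "Hbar 0 (Sup (level_set H c)) = c" "Sup (level_set H c) < \<theta> \<Longrightarrow> c < Hbar 0 \<theta>"
proof -
  have "Sup (level_set H c) \<in> level_set H c"
    by (rule closed_contains_Sup) (use assms closed_level_set level_set_nonempty in auto)
  then show eq: "Hbar 0 (Sup (level_set H c)) = c" by (simp add: level_set_def)
  assume lt: "Sup (level_set H c) < \<theta>"
  then have "Hbar 0 \<theta> \<noteq> c" using cSup_upper[OF _ assms(2), of \<theta>] by (auto simp: level_set_def)
  moreover have "c \<le> Hbar 0 \<theta>" using Hbar_mono[of "Sup (level_set H c)" \<theta> 0] lt eq by simp
  ultimately show "c < Hbar 0 \<theta>" by simp
qed

theorem u_minus_least_solution: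
  assumes c: "c \<in> critical_values H" "bdd_below (level_set H c)" and \<epsilon>: "0 < \<epsilon>"
  shows "u_minus H c \<epsilon> \<in> eps_solutions H c \<epsilon>"
    and "\<omega> \<in> eps_solutions H c \<epsilon> \<Longrightarrow> u_minus H c \<epsilon> x \<le> \<omega> x"
  using least_eps_solution[OF \<epsilon> eps_solutions_nonempty[OF c(1) \<epsilon>] below_level_set(2)[OF c, of "Inf (level_set H c) - 1"]]
  by auto

theorem u_plus_greatest_solution:
  assumes c: "c \<in> critical_values H" "bdd_above (level_set H c)" and \<epsilon>: "0 < \<epsilon>"
  shows "u_plus H c \<epsilon> \<in> eps_solutions H c \<epsilon>"
    and "\<omega> \<in> eps_solutions H c \<epsilon> \<Longrightarrow> \<omega> x \<le> u_plus H c \<epsilon> x"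
  using greatest_eps_solution[OF \<epsilon> eps_solutions_nonempty[OF c(1) \<epsilon>] above_level_set(2)[OF c, of "Sup (level_set H c) + 1"]]
  by auto

theorem u_minus_rate:
  assumes c: "c \<in> critical_values H" "bdd_below (level_set H c)"
  shows "\<exists>C>0. \<forall>\<epsilon>>0. Linf_norm (\<lambda>x. u_minus H c \<epsilon> x - Inf (level_set H c)) \<le> ereal (C * \<epsilon>)"
proof -
  let ?\<theta> = "Inf (level_set H c)"
  obtain C where C: "C > 0" "\<And>\<epsilon> \<omega> x. \<epsilon> > 0 \<Longrightarrow> \<omega> \<in> eps_solutions H c \<epsilon> \<Longrightarrow> ?\<theta> - C * \<epsilon> \<le> \<omega> x"
    using eps_solutions_lower_bound[OF below_level_set(2)[OF c]] by meson
  obtain C' where C': "C' > 0" "\<And>\<epsilon>. \<epsilon> > 0 \<Longrightarrow> \<exists>\<omega>\<in>eps_solutions H c \<epsilon>. \<forall>x. \<omega> x \<le> ?\<theta> + C' * \<epsilon>"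
    using eps_solution_exists[of ?\<theta>] below_level_set(1)[OF c] by metis
  have "Linf_norm (\<lambda>x. u_minus H c \<epsilon> x - ?\<theta>) \<le> ereal ((C + C') * \<epsilon>)" if \<epsilon>: "\<epsilon> > 0" for \<epsilon>
  proof (rule Linf_norm_le)
    note u = u_minus_least_solution[OF c \<epsilon>]
    show "continuous_on UNIV (u_minus H c \<epsilon>)" by (rule eps_solutionsD[OF u(1)])
    fix x
    obtain \<omega> where \<omega>: "\<omega> \<in> eps_solutions H c \<epsilon>" "\<omega> x \<le> ?\<theta> + C' * \<epsilon>" using C'(2)[OF \<epsilon>] by blast
    have "0 \<le> C * \<epsilon>" "0 \<le> C' * \<epsilon>" using C(1) C'(1) \<epsilon> by simp_all
    then show "\<bar>u_minus H c \<epsilon> x - ?\<theta>\<bar> \<le> (C + C') * \<epsilon>"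
      using C(2)[OF \<epsilon> u(1), of x] u(2)[OF \<omega>(1), of x] \<omega>(2) by (simp add: abs_le_iff distrib_right)
  qed
  then show ?thesis using C C' by (intro exI[of _ "C + C'"]) auto
qed

theorem u_plus_rate:
  assumes c: "c \<in> critical_values H" "bdd_above (level_set H c)"
  shows "\<exists>C>0. \<forall>\<epsilon>>0. Linf_norm (\<lambda>x. u_plus H c \<epsilon> x - Sup (level_set H c)) \<le> ereal (C * \<epsilon>)"
proof -
  let ?\<theta> = "Sup (level_set H c)"
  obtain C where C: "C > 0" "\<And>\<epsilon> \<omega> x. \<epsilon> > 0 \<Longrightarrow> \<omega> \<in> eps_solutions H c \<epsilon> \<Longrightarrow> \<omega> x \<le> ?\<theta> + C * \<epsilon>"
    using eps_solutions_upper_bound[OF above_level_set(2)[OF c]] by meson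
  obtain C' where C': "C' > 0" "\<And>\<epsilon>. \<epsilon> > 0 \<Longrightarrow> \<exists>\<omega>\<in>eps_solutions H c \<epsilon>. \<forall>x. ?\<theta> - C' * \<epsilon> \<le> \<omega> x"
    using eps_solution_exists[of ?\<theta>] above_level_set(1)[OF c] by metis
  have "Linf_norm (\<lambda>x. u_plus H c \<epsilon> x - ?\<theta>) \<le> ereal ((C + C') * \<epsilon>)" if \<epsilon>: "\<epsilon> > 0" for \<epsilon>
  proof (rule Linf_norm_le)
    note u = u_plus_greatest_solution[OF c \<epsilon>]
    show "continuous_on UNIV (u_plus H c \<epsilon>)" by (rule eps_solutionsD[OF u(1)])
    fix x
    obtain \<omega> where \<omega>: "\<omega> \<in> eps_solutions H c \<epsilon>" "?\<theta> - C' * \<epsilon> \<le> \<omega> x" using C'(2)[OF \<epsilon>] by blast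
    have "0 \<le> C * \<epsilon>" "0 \<le> C' * \<epsilon>" using C(1) C'(1) \<epsilon> by simp_all
    then show "\<bar>u_plus H c \<epsilon> x - ?\<theta>\<bar> \<le> (C + C') * \<epsilon>"
      using C(2)[OF \<epsilon> u(1), of x] u(2)[OF \<omega>(1), of x] \<omega>(2) by (simp add: abs_le_iff distrib_right)
  qed
  then show ?thesis using C C' by (intro exI[of _ "C + C'"]) auto
qed

lemma singleton_level_set:
  assumes "level_set H c = {\<theta>}"
  shows "Hbar 0 \<theta> = c" "\<theta>' < \<theta> \<Longrightarrow> Hbar 0 \<theta>' < c" "\<theta> < \<theta>' \<Longrightarrow> c < Hbar 0 \<theta>'"
proof -
  have iff: "Hbar 0 s = c \<longleftrightarrow> s = \<theta>" for s using assms by (auto simp: level_set_def)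
  then show "Hbar 0 \<theta> = c" by simp
  then show "\<theta>' < \<theta> \<Longrightarrow> Hbar 0 \<theta>' < c" "\<theta> < \<theta>' \<Longrightarrow> c < Hbar 0 \<theta>'"
    using Hbar_mono[of \<theta>' \<theta> 0] Hbar_mono[of \<theta> \<theta>' 0] iff[of \<theta>'] by force+
qed

theorem homogenized_unique:
  assumes "level_set H c = {\<theta>}"
  shows "BUC \<inter> homogenized_solutions H c = {\<lambda>x. \<theta>}"
proof (intro equalityI subsetI)
  note level = singleton_level_set[OF assms]
  fix u :: "real^'n \<Rightarrow> real" assume "u \<in> {\<lambda>x. \<theta>}"
  then have u: "u = (\<lambda>x. \<theta>)" by simp
  have "u \<in> BUC" unfolding u BUC_def by (auto intro: uniformly_continuous_on_const)
  then show "u \<in> BUC \<inter> homogenized_solutions H c"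
    using constant_homogenized_solution[of \<theta>] level(1) u by simp
next
  note level = singleton_level_set[OF assms]
  fix u assume u: "u \<in> BUC \<inter> homogenized_solutions H c"
  then have c: "continuous_on UNIV u" and sub: "viscosity_subsolution (\<lambda>x. Hbar) c u"
    and super: "viscosity_supersolution (\<lambda>x. Hbar) c u"
    by (auto simp: homogenized_solutions_def viscosity_solution_def)
  obtain B where B: "\<And>x. \<bar>u x\<bar> \<le> B" using u by (auto simp: BUC_def bounded_iff)
  have cont: "continuous_on UNIV (\<lambda>p. Hbar p s)" for s
    by (intro continuous_on_Hbar continuous_intros)
  have "u x = \<theta>" for x
  proof (rule antisym)
    show "u x \<le> \<theta>"
    proof (rule ccontr)
      assume "\<not> u x \<le> \<theta>"
      then obtain s where s: "\<theta> < s" "s < u x" using dense[of \<theta> "u x"] by auto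
      have "Hbar 0 s \<le> c" by (rule subsolution_range_bound[OF c B sub Hbar_mono cont s(2)])
      then show False using level(3)[OF s(1)] by simp
    qed
    show "\<theta> \<le> u x"
    proof (rule ccontr)
      assume "\<not> \<theta> \<le> u x"
      then obtain s where s: "u x < s" "s < \<theta>" using dense[of "u x" \<theta>] by auto
      have "c \<le> Hbar 0 s" by (rule supersolution_range_bound[OF c B super Hbar_mono cont s(1)])
      then show False using level(2)[OF s(2)] by simp
    qed
  qed
  then show "u \<in> {\<lambda>x. \<theta>}" by auto
qed

theorem eps_solutions_rate:
  assumes "level_set H c = {\<theta>}"
  shows "\<exists>C>0. \<forall>\<epsilon>>0. \<forall>u\<in>eps_solutions H c \<epsilon>. Linf_norm (\<lambda>x. u x - \<theta>) \<le> ereal (C * \<epsilon>)"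
proof -
  note level = singleton_level_set[OF assms]
  obtain C where C: "C > 0" "\<And>\<epsilon> \<omega> x. \<epsilon> > 0 \<Longrightarrow> \<omega> \<in> eps_solutions H c \<epsilon> \<Longrightarrow> \<theta> - C * \<epsilon> \<le> \<omega> x"
    using eps_solutions_lower_bound[OF level(2)] by meson
  obtain C' where C': "C' > 0" "\<And>\<epsilon> \<omega> x. \<epsilon> > 0 \<Longrightarrow> \<omega> \<in> eps_solutions H c \<epsilon> \<Longrightarrow> \<omega> x \<le> \<theta> + C' * \<epsilon>"
    using eps_solutions_upper_bound[OF level(3)] by meson
  have "Linf_norm (\<lambda>x. u x - \<theta>) \<le> ereal ((C + C') * \<epsilon>)"
    if \<epsilon>: "\<epsilon> > 0" and u: "u \<in> eps_solutions H c \<epsilon>" for \<epsilon> u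
  proof (rule Linf_norm_le)
    show "continuous_on UNIV u" by (rule eps_solutionsD[OF u])
    have "0 \<le> C * \<epsilon>" "0 \<le> C' * \<epsilon>" using C(1) C'(1) \<epsilon> by simp_all
    then show "\<bar>u x - \<theta>\<bar> \<le> (C + C') * \<epsilon>" for x
      using C(2)[OF \<epsilon> u, of x] C'(2)[OF \<epsilon> u, of x] by (simp add: abs_le_iff distrib_right)
  qed
  then show ?thesis using C C' by (intro exI[of _ "C + C'"]) auto
qed

end

section \<open>Coercivity of superlinear convex Hamiltonians\<close>

text \<open>
  By compactness of the cell times the unit sphere, finitely many radii \<open>N\<close> suffice such that on each
  ray from the origin \<open>G x\<close> has grown by more than 1 at one of them.  Convexity along the ray then
  forces at least linear growth of \<open>G x\<close> beyond that radius, with a slope that is uniform in \<open>x\<close>.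
\<close>

lemma convex_superlinear_imp_coercive:
  fixes G :: "real^'n \<Rightarrow> real^'n \<Rightarrow> real"
  assumes periodic: "\<And>p. lattice_periodic 1 (\<lambda>x. G x p)"
    and cont: "continuous_on UNIV (\<lambda>(x, p). G x p)"
    and convex: "\<And>x. convex_on UNIV (G x)"
    and superlinear: "\<And>x. filterlim (\<lambda>p. G x p / norm p) at_top at_infinity"
  shows "\<exists>K>0. \<forall>x p. G x p \<le> M \<longrightarrow> norm p < K"
proof -
  have G: "continuous_on S (\<lambda>z. G (f z) (g z))" if "continuous_on S f" "continuous_on S g"
    for S :: "'b::topological_space set" and f g
  proof -
    have "continuous_on S (\<lambda>z. (\<lambda>(x, p). G x p) (f z, g z))"
      by (rule continuous_on_compose2[OF cont]) (auto intro!: continuous_intros that)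
    then show ?thesis by simp
  qed
  have "continuous_on UNIV (\<lambda>x. G x 0)" by (intro G continuous_intros)
  then obtain A where A: "\<And>x. \<bar>G x 0\<bar> \<le> A" using periodic_bounded[OF periodic, of 0] by auto
  let ?S = "(cell 1 :: (real^'n) set) \<times> sphere (0 :: real^'n) 1"
  define U where "U N = {z. G (fst z) 0 + 1 < G (fst z) (real N *\<^sub>R snd z)}" for N
  have "compact ?S" by (intro compact_Times compact_cell compact_sphere)
  moreover have "open (U N)" for N
    unfolding U_def by (intro open_Collect_less continuous_intros G)
  moreover have "?S \<subseteq> (\<Union>N\<in>{1..}. U N)"
  proof
    fix z assume "z \<in> ?S"
    then obtain x e where z: "z = (x, e)" "norm e = 1" by auto
    obtain R where R: "\<And>p. R \<le> norm p \<Longrightarrow> \<bar>G x 0\<bar> + 2 \<le> G x p / norm p"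
      using superlinear[of x] unfolding filterlim_at_top eventually_at_infinity by metis
    obtain N :: nat where N: "max R 1 \<le> real N" using real_arch_simple by blast
    have "\<bar>G x 0\<bar> + 2 \<le> G x (real N *\<^sub>R e) / norm (real N *\<^sub>R e)" using N z by (intro R) simp
    then have "(\<bar>G x 0\<bar> + 2) * real N \<le> G x (real N *\<^sub>R e)" using N z by (simp add: field_simps)
    moreover have "(\<bar>G x 0\<bar> + 2) * 1 \<le> (\<bar>G x 0\<bar> + 2) * real N" using N by (intro mult_left_mono) auto
    ultimately have "z \<in> U N" by (simp add: U_def z)
    then show "z \<in> (\<Union>N\<in>{1..}. U N)" using N by auto
  qed
  ultimately obtain T where T: "T \<subseteq> {1..}" "finite T" "?S \<subseteq> (\<Union>N\<in>T. U N)"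
    by (rule compactE_image)
  \<comment> \<open>Any upper bound of the finite set \<open>T\<close> would do; the sum exists even if \<open>T\<close> is empty.\<close>
  define N0 where "N0 = real (\<Sum>T)"
  have N0: "real N \<le> N0" if "N \<in> T" for N
    unfolding N0_def using member_le_sum[OF that, of "\<lambda>x. x"] T(2) by (simp del: of_nat_sum)
  have N0_nonneg: "0 \<le> N0" unfolding N0_def by (rule of_nat_0_le_iff)
  define K where "K = N0 * (1 + \<bar>M + A\<bar>) + 1"
  have "norm p < K" if le: "G x p \<le> M" for x p
  proof (cases "norm p \<le> N0")
    case True
    have "0 \<le> N0 * \<bar>M + A\<bar>" using N0_nonneg by simp
    then show ?thesis using True by (simp add: K_def distrib_left)
  next
    case False
    obtain k where k: "\<And>i. k $ i \<in> \<int>" "x + 1 *\<^sub>R k \<in> cell 1" using cell_representative[of 1 x] by auto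
    define y where "y = x + 1 *\<^sub>R k"
    have y: "y \<in> cell 1" "G y q = G x q" for q
      using k(2) periodicD[OF periodic k(1)] by (simp_all add: y_def)
    have p0: "norm p > 0" using False N0_nonneg by linarith
    have "(y, sgn p) \<in> ?S" using y p0 by (simp add: norm_sgn)
    then obtain N where N: "N \<in> T" "(y, sgn p) \<in> U N" using T(3) by blast
    have N1: "real N \<ge> 1" using N(1) T(1) by auto
    define t where "t = real N / norm p"
    have t: "0 < t" "t \<le> 1" using N1 N0[OF N(1)] False p0 by (auto simp: t_def)
    have "real N *\<^sub>R sgn p = (1 - t) *\<^sub>R 0 + t *\<^sub>R p" by (simp add: t_def sgn_div_norm divide_inverse)
    then have "G y (real N *\<^sub>R sgn p) \<le> (1 - t) * G y 0 + t * G y p"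
      using convex_onD[OF convex, of t 0 p y] t by simp
    then have "1 < t * (G y p - G y 0)" using N(2) by (simp add: U_def algebra_simps)
    also have "\<dots> \<le> t * (M + A)"
      using le y(2) A[of y] t by (intro mult_left_mono) (auto simp: abs_le_iff)
    also have "\<dots> \<le> t * \<bar>M + A\<bar>" using t by (intro mult_left_mono) auto
    finally have "norm p < real N * \<bar>M + A\<bar>" using p0 by (simp add: t_def field_simps)
    also have "\<dots> \<le> N0 * \<bar>M + A\<bar>" using N0[OF N(1)] by (intro mult_right_mono) auto
    finally show ?thesis using N0_nonneg by (simp add: K_def distrib_left)
  qed
  moreover have "K > 0" using N0_nonneg by (auto simp: K_def intro!: add_nonneg_pos)
  ultimately show ?thesis by blast
qed

section \<open>Homogenization\<close>

theorem theorem1p1: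
  fixes H :: "real^'n \<Rightarrow> real^'n \<Rightarrow> real \<Rightarrow> real"
  assumes periodic: "\<forall>p \<theta>. lattice_periodic 1 (\<lambda>x. H x p \<theta>)"
    and cont: "continuous_on UNIV (\<lambda>(x, p, \<theta>). H x p \<theta>)"
    and A1: "\<forall>x \<theta>. convex_on UNIV (\<lambda>p. H x p \<theta>)"
    and A2: "\<forall>x \<theta>. filterlim (\<lambda>p. H x p \<theta> / norm p) at_top at_infinity"
    and A3_diff: "\<forall>x p \<theta>. (\<lambda>s. H x p s) differentiable (at \<theta>)"
    and A3_cont: "continuous_on UNIV (\<lambda>(x, p, \<theta>). deriv (\<lambda>s. H x p s) \<theta>)"
    and A3_nonneg: "\<forall>x p \<theta>. deriv (\<lambda>s. H x p s) \<theta> \<ge> 0"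
  shows
    "((\<forall>c\<in>critical_values H.
         (\<forall>\<epsilon>>0. eps_solutions H c \<epsilon> \<noteq> {}) \<and> homogenized_solutions H c \<noteq> {})
      \<and> connected (critical_values H))
     \<and>
     (\<forall>c\<in>interior (critical_values H).
        (bdd_below (level_set H c) \<longrightarrow>
           (\<forall>\<epsilon>>0. u_minus H c \<epsilon> \<in> eps_solutions H c \<epsilon> \<and>
                   (\<forall>\<omega>\<in>eps_solutions H c \<epsilon>. \<forall>x. u_minus H c \<epsilon> x \<le> \<omega> x))) \<and>
        (bdd_above (level_set H c) \<longrightarrow>
           (\<forall>\<epsilon>>0. u_plus H c \<epsilon> \<in> eps_solutions H c \<epsilon> \<and>
                   (\<forall>\<omega>\<in>eps_solutions H c \<epsilon>. \<forall>x. \<omega> x \<le> u_plus H c \<epsilon> x))) \<and>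
        (\<exists>C>0.
           (bdd_below (level_set H c) \<longrightarrow>
              (\<forall>\<epsilon>\<in>{0<..1}.
                 Linf_norm (\<lambda>x. u_minus H c \<epsilon> x - Inf (level_set H c)) \<le> ereal (C * \<epsilon>))) \<and>
           (bdd_above (level_set H c) \<longrightarrow>
              (\<forall>\<epsilon>\<in>{0<..1}.
                 Linf_norm (\<lambda>x. u_plus H c \<epsilon> x - Sup (level_set H c)) \<le> ereal (C * \<epsilon>)))))
     \<and>
     (\<forall>c\<in>critical_values H. \<forall>\<theta>. level_set H c = {\<theta>} \<longrightarrow>
        BUC \<inter> homogenized_solutions H c = {\<lambda>x. \<theta>} \<and>
        (\<exists>C>0. \<forall>\<epsilon>\<in>{0<..1}. \<forall>u\<in>eps_solutions H c \<epsilon>.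
           Linf_norm (\<lambda>x. u x - \<theta>) \<le> ereal (C * \<epsilon>)))"
proof -
  interpret monotone_coercive_hamiltonian H
  proof
    show "lattice_periodic 1 (\<lambda>x. H x p \<theta>)" for p \<theta> using periodic by blast
    show "continuous_on UNIV (\<lambda>(x, p, \<theta>). H x p \<theta>)" by (rule cont)
    show "H x p s \<le> H x p t" if "s \<le> t" for s t x p
      using that
    proof (rule DERIV_nonneg_imp_nondecreasing)
      fix r
      have "((\<lambda>s. H x p s) has_real_derivative deriv (\<lambda>s. H x p s) r) (at r)"
        using A3_diff by (simp add: DERIV_deriv_iff_real_differentiable)
      then show "\<exists>y. ((\<lambda>s. H x p s) has_real_derivative y) (at r) \<and> 0 \<le> y"
        using A3_nonneg by blast
    qed
    show "\<exists>K>0. \<forall>x p. H x p \<theta> \<le> M \<longrightarrow> norm p < K" for \<theta> M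
    proof (rule convex_superlinear_imp_coercive)
      have "continuous_on UNIV (\<lambda>z. (\<lambda>(x, p, \<theta>). H x p \<theta>) (fst z, snd z, \<theta>))"
        by (rule continuous_on_compose2[OF cont]) (auto intro!: continuous_intros)
      then show "continuous_on UNIV (\<lambda>(x, p). H x p \<theta>)" by (simp add: case_prod_beta)
    qed (use periodic A1 A2 in blast)+
  qed
  have "(\<forall>\<epsilon>>0. eps_solutions H c \<epsilon> \<noteq> {}) \<and> homogenized_solutions H c \<noteq> {}"
    if "c \<in> critical_values H" for c
    using eps_solutions_nonempty[OF that] that constant_homogenized_solution
    unfolding critical_values_eq by blast
  moreover have "\<exists>C>0.
           (bdd_below (level_set H c) \<longrightarrow>
              (\<forall>\<epsilon>\<in>{0<..1}.
                 Linf_norm (\<lambda>x. u_minus H c \<epsilon> x - Inf (level_set H c)) \<le> ereal (C * \<epsilon>))) \<and>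
           (bdd_above (level_set H c) \<longrightarrow>
              (\<forall>\<epsilon>\<in>{0<..1}.
                 Linf_norm (\<lambda>x. u_plus H c \<epsilon> x - Sup (level_set H c)) \<le> ereal (C * \<epsilon>)))"
    if c: "c \<in> critical_values H" for c
  proof -
    obtain C where C: "C > 0" "bdd_below (level_set H c) \<Longrightarrow> \<epsilon> > 0 \<Longrightarrow>
        Linf_norm (\<lambda>x. u_minus H c \<epsilon> x - Inf (level_set H c)) \<le> ereal (C * \<epsilon>)" for \<epsilon>
      using u_minus_rate[OF c] zero_less_one by metis
    obtain C' where C': "C' > 0" "bdd_above (level_set H c) \<Longrightarrow> \<epsilon> > 0 \<Longrightarrow>
        Linf_norm (\<lambda>x. u_plus H c \<epsilon> x - Sup (level_set H c)) \<le> ereal (C' * \<epsilon>)" for \<epsilon>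
      using u_plus_rate[OF c] zero_less_one by metis
    have le: "ereal (C * \<epsilon>) \<le> ereal (max C C' * \<epsilon>)" "ereal (C' * \<epsilon>) \<le> ereal (max C C' * \<epsilon>)"
      if "\<epsilon> > 0" for \<epsilon> using that by (simp_all add: mult_right_mono)
    show ?thesis
      by (intro exI[of _ "max C C'"] conjI impI ballI)
         (use C C' in \<open>auto intro: order_trans[OF C(2) le(1)] order_trans[OF C'(2) le(2)]\<close>)
  qed
  moreover have "c \<in> critical_values H" if "c \<in> interior (critical_values H)" for c
    using that interior_subset by blast
  moreover have "\<exists>C>0. \<forall>\<epsilon>\<in>{0<..1}. \<forall>u\<in>eps_solutions H c \<epsilon>. Linf_norm (\<lambda>x. u x - \<theta>) \<le> ereal (C * \<epsilon>)"
    if "level_set H c = {\<theta>}" for c \<theta>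
    using eps_solutions_rate[OF that] by (meson greaterThanAtMost_iff)
  ultimately show ?thesis
    using connected_critical_values u_minus_least_solution u_plus_greatest_solution homogenized_unique
    by (intro conjI ballI allI impI) auto
qed

end
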